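(* Let $n\ge 3$ be an integer. Every local automorphism $\phi : SL_n(\mathbb{R}) \to SL_n(\mathbb{R})$ of the group $SL_n(\mathbb R)$ is an automorphism of the group $SL_n(\mathbb{R})$.
   Context: A map $\phi: G\to G$ on a group $G$ (no algebraic property or bijectivity assumed) is called a local automorphism of $G$ if for every pair $a,b\in G$ there exists a group automorphism $\phi_{a,b}:G\to G$ (depending on $a,b$) such that $\phi(a)=\phi_{a,b}(a)$ and $\phi(b)=\phi_{a,b}(b)$. $SL_n(\mathbb R)$ is the group of real $n\times n$ matrices with determinant $1$. Automorphisms are abstract group automorphisms (no continuity assumed). *)

theory Defs
  imports "HOL-Analysis.Determinants" "HOL-Algebra.Group"
begin

definition special_linear_group :: "(real ^ 'n ^ 'n) monoid" where
  "special_linear_group = \<lparr>carrier = {A. det A = 1}, mult = (**), one = mat 1\<rparr>"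

lemma group_special_linear_group:
  "group (special_linear_group :: (real ^ 'n ^ 'n) monoid)"
proof (rule groupI)
  fix A :: "real ^ 'n ^ 'n"
  assume "A \<in> carrier special_linear_group"
  then have A: "det A = 1"
    by (simp add: special_linear_group_def)
  then have "invertible A"
    by (simp add: invertible_det_nz)
  then obtain B where B: "B ** A = mat 1"
    unfolding invertible_def by blast
  then have "det B = 1"
    using A by (metis det_I det_mul mult.right_neutral)
  with B show "\<exists>B \<in> carrier special_linear_group.
      B \<otimes>\<^bsub>special_linear_group\<^esub> A = \<one>\<^bsub>special_linear_group\<^esub>"
    by (auto simp: special_linear_group_def)
qed (auto simp: special_linear_group_def det_mul matrix_mul_assoc)

text \<open>Here \<^term>\<open>iso G G\<close> is the set of automorphisms of \<^term>\<open>G\<close>, which are unconstrained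
  outside the carrier. Only the values of \<^term>\<open>\<phi>\<close> on the carrier matter.\<close>

definition local_automorphism :: "('a, 'b) monoid_scheme \<Rightarrow> ('a \<Rightarrow> 'a) \<Rightarrow> bool" where
  "local_automorphism G \<phi> \<longleftrightarrow>
     \<phi> \<in> carrier G \<rightarrow> carrier G \<and>
     (\<forall>a \<in> carrier G. \<forall>b \<in> carrier G. \<exists>\<psi> \<in> iso G G. \<phi> a = \<psi> a \<and> \<phi> b = \<psi> b)"

end

theory Submission imports Defs "HOL-Analysis.Cartesian_Space" begin

text \<open>
Every automorphism of the special linear group is \<open>A \<mapsto> P A P\<inverse>\<close>, possibly preceded by the
contragredient \<open>A \<mapsto> (A\<inverse>)\<^sup>T\<close>. To see this, note that the diagonal sign matrices are mapped to
commuting involutions, hence, after a conjugation, to themselves; then their centralizer, the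
diagonal torus, is preserved. The image of a root subgroup is a commutative group whose nontrivial
elements form one orbit of the torus, which forces it to be a root subgroup again. The induced
bijection of the roots comes from a permutation of the indices, up to transposition, and after
normalization the automorphism acts on the parameters of the root subgroups by a ring endomorphism
of the reals, that is, by the identity.

For a local automorphism \<open>\<phi>\<close> one may assume that it fixes a diagonal matrix \<open>D\<close> with distinct entries
and \<open>tr D \<noteq> tr D\<inverse>\<close>. Then each \<open>\<phi> B\<close> is conjugate to \<open>B\<close> by a diagonal matrix, and one may further
assume that \<open>\<phi>\<close> fixes a matrix \<open>u\<close> without zero entries. For \<open>A = D (1 + E\<^sub>i\<^sub>j)\<close> the trace excludes the
contragredient type, so \<open>tr (\<phi> A \<phi> B) = tr (A B)\<close> for all \<open>B\<close>. The case \<open>B = u\<close> gives \<open>\<phi> A = A\<close>, and then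
the identity reads off the \<open>(j, i)\<close> entry of \<open>\<phi> B\<close>.
\<close>

section \<open>Diagonal matrices and transvections\<close>

definition SL :: "(real^'n^'n) set" where
  "SL = {A. det A = 1}"

definition sl_aut :: "(real^'n^'n \<Rightarrow> real^'n^'n) \<Rightarrow> bool" where
  "sl_aut f \<longleftrightarrow> bij_betw f SL SL \<and> (\<forall>A\<in>SL. \<forall>B\<in>SL. f (A ** B) = f A ** f B)"

definition diagm :: "('n \<Rightarrow> real) \<Rightarrow> real^'n^'n" where
  "diagm d = (\<chi> i j. if i = j then d i else 0)"

definition transv :: "'n \<Rightarrow> 'n \<Rightarrow> real \<Rightarrow> real^'n^'n" where
  "transv i j s = (\<chi> k l. of_bool (k = l) + (if k = i \<and> l = j then s else 0))"

lemma ex_third: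
  assumes "CARD('n::finite) \<ge> 3"
  obtains k :: "'n::finite" where "k \<noteq> i" "k \<noteq> j"
proof -
  have "card {i, j} \<le> 2" by (simp add: card_insert_le_m1)
  then have "{i, j} \<noteq> UNIV" using assms by auto
  then show ?thesis using that by blast
qed

lemma diagm_nth: "diagm d $ i $ j = (if i = j then d i else 0)"
  by (simp add: diagm_def)

lemma transv_nth: "transv i j s $ k $ l = of_bool (k = l) + (if k = i \<and> l = j then s else 0)"
  by (simp add: transv_def)

lemma diagm_mult_nth: "(diagm d ** A) $ i $ j = d i * A $ i $ j"
  by (simp add: matrix_matrix_mult_def diagm_nth if_distrib[of "\<lambda>x. x * y" for y] cong: if_cong)

lemma mult_diagm_nth: "(A ** diagm d) $ i $ j = A $ i $ j * d j"
  by (simp add: matrix_matrix_mult_def diagm_nth if_distrib[of "\<lambda>x. y * x" for y] cong: if_cong)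

lemma transv_mult_nth: "(transv i j s ** A) $ k $ l = A $ k $ l + (if k = i then s * A $ j $ l else 0)"
proof -
  have "(transv i j s ** A) $ k $ l =
      (\<Sum>m\<in>UNIV. (if m = k then A $ m $ l else 0) + (if m = j then (if k = i then s * A $ m $ l else 0) else 0))"
    unfolding matrix_matrix_mult_def transv_def vec_lambda_beta
    by (intro sum.cong refl) (auto simp: algebra_simps)
  also have "\<dots> = A $ k $ l + (if k = i then s * A $ j $ l else 0)"
    by (simp only: sum.distrib sum.delta finite UNIV_I if_True)
  finally show ?thesis .
qed

lemma diagm_mult: "diagm d ** diagm e = diagm (\<lambda>i. d i * e i)"
  by (simp add: vec_eq_iff diagm_mult_nth) (simp add: diagm_nth)

lemma diagm_one: "diagm (\<lambda>i. 1) = mat 1"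
  by (simp add: vec_eq_iff diagm_nth mat_def)

lemma diagm_inverse:
  assumes "\<And>i. d i \<noteq> 0"
  shows "diagm d ** diagm (\<lambda>i. inverse (d i)) = mat 1" "diagm (\<lambda>i. inverse (d i)) ** diagm d = mat 1"
  using assms by (simp_all add: diagm_mult diagm_one)

lemma diagm_eq_iff: "diagm d = diagm e \<longleftrightarrow> d = e"
  by (auto simp: vec_eq_iff diagm_nth fun_eq_iff)

lemma transv_0 [simp]: "transv i j 0 = mat 1"
  by (simp add: vec_eq_iff transv_nth mat_def)

lemma transv_eq_iff: "i \<noteq> j \<Longrightarrow> transv i j s = transv i j t \<longleftrightarrow> s = t"
  by (auto simp: vec_eq_iff transv_nth dest: spec[of _ i])

lemma transv_eq_one_iff: "i \<noteq> j \<Longrightarrow> transv i j s = mat 1 \<longleftrightarrow> s = 0"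
  using transv_eq_iff[of i j s 0] by simp

lemma transv_add: "i \<noteq> j \<Longrightarrow> transv i j s ** transv i j t = transv i j (s + t)"
  by (auto simp: vec_eq_iff transv_mult_nth) (auto simp: transv_nth)

lemma diagm_transv: 
  assumes "\<And>k. d k \<noteq> 0"
  shows "diagm d ** transv i j s = transv i j (d i * s / d j) ** diagm d"
  using assms by (auto simp: vec_eq_iff diagm_mult_nth mult_diagm_nth transv_nth)

lemma det_diagm: "det (diagm d) = prod d UNIV"
  by (subst det_diagonal) (auto simp: diagm_nth)

lemma det_transv: "i \<noteq> j \<Longrightarrow> det (transv i j s) = 1"
proof -
  assume "i \<noteq> j"
  have "transv i j s = (\<chi> k. if k = i then row i (mat 1) + s *s row j (mat 1) else row k (mat 1))"
    by (auto simp: vec_eq_iff transv_nth row_def mat_def)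
  then show ?thesis using det_row_operation[OF \<open>i \<noteq> j\<close>, where A = "mat 1" and c = s] by simp
qed

text \<open>Up to the factor \<open>s * t\<close>, the commutator of the nilpotent parts is
  \<open>[b = c] E_ad - [d = a] E_cb\<close>, and the two terms cannot cancel as
  \<open>a \<noteq> b\<close>. This relation between roots is what an automorphism respects.\<close>

lemma transv_commute_iff:
  assumes "a \<noteq> b" "c \<noteq> d" "s \<noteq> 0" "t \<noteq> 0"
  shows "transv a b s ** transv c d t = transv c d t ** transv a b s \<longleftrightarrow> b \<noteq> c \<and> a \<noteq> d"
proof
  assume "b \<noteq> c \<and> a \<noteq> d"
  then show "transv a b s ** transv c d t = transv c d t ** transv a b s"
    by (auto simp: vec_eq_iff transv_mult_nth) (auto simp: transv_nth)
next
  assume eq: "transv a b s ** transv c d t = transv c d t ** transv a b s"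
  show "b \<noteq> c \<and> a \<noteq> d"
  proof (rule ccontr)
    assume "\<not> (b \<noteq> c \<and> a \<noteq> d)"
    then consider "b = c" | "a = d" by blast
    then show False
    proof cases
      case 1
      then show False using arg_cong[OF eq, of "\<lambda>M. M $ a $ d"] assms
        by (auto simp: transv_mult_nth transv_nth split: if_splits)
    next
      case 2
      then show False using arg_cong[OF eq, of "\<lambda>M. M $ c $ b"] assms
        by (auto simp: transv_mult_nth transv_nth split: if_splits)
    qed
  qed
qed

text \<open>The Steinberg commutator relation, freed of inverses; through it an automorphism sees
  the multiplication of the parameters.\<close>

lemma transv_commutator:
  assumes "i \<noteq> j" "j \<noteq> k" "i \<noteq> k"
  shows "transv i j s ** transv j k t = transv i k (s * t) ** transv j k t ** transv i j s"
  using assms by (auto simp: vec_eq_iff transv_mult_nth matrix_mul_assoc[symmetric]) (auto simp: transv_nth)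

section \<open>Elements and automorphisms of the group \<open>SL\<close>\<close>

lemma SL_D: "A \<in> SL \<Longrightarrow> det A = 1"
  by (auto simp: SL_def)

lemma SL_mult: "A \<in> SL \<Longrightarrow> B \<in> SL \<Longrightarrow> A ** B \<in> SL"
  by (simp add: SL_def det_mul)

lemma SL_one: "mat 1 \<in> SL"
  by (simp add: SL_def)

lemma SL_transv: "i \<noteq> j \<Longrightarrow> transv i j s \<in> SL"
  by (simp add: SL_def det_transv)

lemma SL_diagm: "diagm d \<in> SL \<longleftrightarrow> prod d UNIV = 1"
  by (simp add: SL_def det_diagm)

lemma matrix_inv_works:
  assumes "invertible A" shows "A ** matrix_inv A = mat 1" "matrix_inv A ** A = mat 1"
  using someI_ex[OF assms[unfolded invertible_def]] by (simp_all add: matrix_inv_def)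

lemma SL_inv:
  assumes "A \<in> SL"
  shows "matrix_inv A \<in> SL" "A ** matrix_inv A = mat 1" "matrix_inv A ** A = mat 1"
proof -
  have "invertible A" using assms by (simp add: SL_def invertible_det_nz)
  then show *: "A ** matrix_inv A = mat 1" "matrix_inv A ** A = mat 1"
    by (simp_all add: matrix_inv_works)
  show "matrix_inv A \<in> SL"
    using arg_cong[OF *(1), of det] assms by (simp add: SL_def det_mul)
qed

lemma inv_uniq:
  fixes A :: "real^'n^'n"
  assumes "A ** B = mat 1" shows "matrix_inv A = B"
proof -
  have BA: "B ** A = mat 1" using assms matrix_left_right_inverse by blast
  then have "invertible A" using assms unfolding invertible_def by blast
  then have "A ** matrix_inv A = mat 1" by (simp add: matrix_inv_works)
  then have "B ** (A ** matrix_inv A) = B" by simp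
  then show ?thesis using BA by (simp add: matrix_mul_assoc)
qed

lemma mult_cancel_l:
  fixes A :: "real^'n^'n"
  assumes "A \<in> SL" shows "A ** B = A ** C \<longleftrightarrow> B = C"
  by (metis SL_inv(3)[OF assms] matrix_mul_assoc matrix_mul_lid)

lemma mult_cancel_r:
  fixes A :: "real^'n^'n"
  assumes "A \<in> SL" shows "B ** A = C ** A \<longleftrightarrow> B = C"
  by (metis SL_inv(2)[OF assms] matrix_mul_assoc matrix_mul_rid)

lemma sl_aut_in: "sl_aut f \<Longrightarrow> A \<in> SL \<Longrightarrow> f A \<in> SL"
  by (auto simp: sl_aut_def bij_betw_def)

lemma sl_aut_mult: "sl_aut f \<Longrightarrow> A \<in> SL \<Longrightarrow> B \<in> SL \<Longrightarrow> f (A ** B) = f A ** f B"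
  by (simp add: sl_aut_def)

lemma sl_aut_inj: "sl_aut f \<Longrightarrow> A \<in> SL \<Longrightarrow> B \<in> SL \<Longrightarrow> f A = f B \<longleftrightarrow> A = B"
  by (auto simp: sl_aut_def bij_betw_def inj_on_def)

lemma sl_aut_one: "sl_aut f \<Longrightarrow> f (mat 1) = mat 1"
  by (metis SL_one sl_aut_in sl_aut_mult matrix_mul_lid mult_cancel_l matrix_mul_rid)

lemma sl_aut_surj:
  assumes "sl_aut f" "B \<in> SL" obtains A where "A \<in> SL" "f A = B"
  using assms unfolding sl_aut_def bij_betw_def by (metis imageE)

lemma sl_aut_comp: "sl_aut f \<Longrightarrow> sl_aut g \<Longrightarrow> sl_aut (\<lambda>A. f (g A))"
  unfolding sl_aut_def using bij_betw_trans[of g SL SL f SL]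
  by (auto simp: o_def bij_betw_apply)

lemma sl_aut_inv_into:
  assumes "sl_aut f" shows "sl_aut (inv_into SL f)"
  unfolding sl_aut_def
proof (intro conjI ballI)
  have bij: "bij_betw f SL SL" using assms by (simp add: sl_aut_def)
  then show "bij_betw (inv_into SL f) SL SL" by (rule bij_betw_inv_into)
  fix A B assume "A \<in> (SL :: (real^'a^'a) set)" "B \<in> (SL :: (real^'a^'a) set)"
  then obtain A' B' where "A = f A'" "B = f B'" "A' \<in> SL" "B' \<in> SL"
    by (metis assms sl_aut_surj)
  moreover have "inv_into SL f (f X) = X" if "X \<in> SL" for X
    using bij that by (simp add: bij_betw_inv_into_left)
  ultimately show "inv_into SL f (A ** B) = inv_into SL f A ** inv_into SL f B"
    using assms by (metis SL_mult sl_aut_mult)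
qed

lemma conj_in_SL:
  fixes P :: "real^'n^'n"
  assumes "P ** Q = mat 1" "A \<in> SL" shows "P ** A ** Q \<in> SL"
proof -
  have "det P * det Q = 1" by (metis assms(1) det_I det_mul)
  then show ?thesis using assms(2) by (simp add: SL_def det_mul)
qed

lemma sl_aut_conj:
  fixes P :: "real^'n^'n"
  assumes "P ** Q = mat 1" shows "sl_aut (\<lambda>A. P ** A ** Q)"
proof -
  have QP: "Q ** P = mat 1" using assms matrix_left_right_inverse by blast
  have "bij_betw (\<lambda>A. P ** A ** Q) SL SL"
  proof (rule bij_betw_byWitness[where f' = "\<lambda>A. Q ** A ** P"])
    show "\<forall>a\<in>SL. Q ** (P ** a ** Q) ** P = a"
      by (metis QP matrix_mul_assoc matrix_mul_lid matrix_mul_rid)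
    show "\<forall>a\<in>SL. P ** (Q ** a ** P) ** Q = a"
      by (metis assms matrix_mul_assoc matrix_mul_lid matrix_mul_rid)
  qed (use conj_in_SL assms QP in auto)
  moreover have "P ** (A ** B) ** Q = P ** A ** Q ** (P ** B ** Q)" for A B
    by (metis QP matrix_mul_assoc matrix_mul_rid)
  ultimately show ?thesis by (simp add: sl_aut_def)
qed

definition contragredient :: "real^'n^'n \<Rightarrow> real^'n^'n" where
  "contragredient A = transpose (matrix_inv A)"

lemma contragredient_SL: "A \<in> SL \<Longrightarrow> contragredient A \<in> SL"
  using SL_inv(1)[of A] by (simp add: contragredient_def SL_def)

lemma contragredient_invol:
  fixes A :: "real^'n^'n" assumes "A \<in> SL" shows "contragredient (contragredient A) = A"
proof -
  have "transpose (matrix_inv A) ** transpose A = mat 1"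
    by (metis SL_inv(2)[OF assms] matrix_transpose_mul transpose_mat)
  then have "matrix_inv (transpose (matrix_inv A)) = transpose A" by (rule inv_uniq)
  then show ?thesis by (simp add: contragredient_def)
qed

lemma sl_aut_contragredient: "sl_aut (contragredient :: real^'n^'n \<Rightarrow> real^'n^'n)"
  unfolding sl_aut_def
proof (intro conjI ballI)
  show "bij_betw contragredient SL (SL :: (real^'n^'n) set)"
    by (rule bij_betw_byWitness[where f' = contragredient])
      (auto simp: contragredient_invol contragredient_SL)
  fix A B :: "real^'n^'n" assume "A \<in> SL" "B \<in> SL"
  then have "A ** B ** (matrix_inv B ** matrix_inv A) = mat 1"
    by (metis SL_inv(2) matrix_mul_assoc matrix_mul_rid)
  then have "matrix_inv (A ** B) = matrix_inv B ** matrix_inv A" by (rule inv_uniq)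
  then show "contragredient (A ** B) = contragredient A ** contragredient B"
    by (simp add: contragredient_def matrix_transpose_mul)
qed

lemma contragredient_transv:
  assumes "i \<noteq> j" shows "contragredient (transv i j s) = transv j i (- s)"
proof -
  have "matrix_inv (transv i j s) = transv i j (- s)"
    using assms by (intro inv_uniq) (simp add: transv_add)
  then show ?thesis
    by (simp add: contragredient_def transpose_def vec_eq_iff transv_nth)
qed

section \<open>Generation by transvections\<close>

inductive_set transv_grp :: "(real^'n^'n) set" where
  one: "mat 1 \<in> transv_grp"
| step: "A \<in> transv_grp \<Longrightarrow> i \<noteq> j \<Longrightarrow> transv i j s ** A \<in> transv_grp"

lemma transv_grp_transv: "i \<noteq> j \<Longrightarrow> transv i j s \<in> transv_grp"
  using transv_grp.step[OF transv_grp.one] by simp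

lemma transv_grp_mult: "A \<in> transv_grp \<Longrightarrow> B \<in> transv_grp \<Longrightarrow> A ** B \<in> transv_grp"
  by (induction rule: transv_grp.induct) (auto simp flip: matrix_mul_assoc intro: transv_grp.step)

lemma transv_grp_det: "A \<in> transv_grp \<Longrightarrow> det A = 1"
  by (induction rule: transv_grp.induct) (simp_all add: det_mul det_transv)

text \<open>This serves to collect diagonal factors on the right of generated ones.\<close>

lemma diagm_normalizes_transv_grp:
  assumes "A \<in> transv_grp" "\<And>i. d i \<noteq> 0"
  obtains A' where "A' \<in> transv_grp" "diagm d ** A = A' ** diagm d"
proof -
  have "\<exists>A'\<in>transv_grp. diagm d ** A = A' ** diagm d"
    using assms(1)
  proof induction
    case one
    show ?case by (intro bexI[of _ "mat 1"] transv_grp.one) simp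
  next
    case (step A i j s)
    then obtain A' where A': "A' \<in> transv_grp" "diagm d ** A = A' ** diagm d" by blast
    have "diagm d ** (transv i j s ** A) = transv i j (d i * s / d j) ** (diagm d ** A)"
      by (simp add: matrix_mul_assoc diagm_transv[OF assms(2)])
    then show ?case using A' step(2) by (metis transv_grp.step matrix_mul_assoc)
  qed
  then show ?thesis using that by blast
qed

text \<open>A monomial matrix that exchanges two coordinates up to the factors \<open>r\<close> and
  \<open>- 1 / r\<close>. The product form makes membership in \<open>transv_grp\<close>
  immediate.\<close>

definition weyl :: "'n \<Rightarrow> 'n \<Rightarrow> real \<Rightarrow> real^'n^'n" where
  "weyl i j r = transv i j r ** (transv j i (- 1 / r) ** transv i j r)"

lemma weyl_nth:
  assumes "i \<noteq> j" "r \<noteq> 0"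
  shows "weyl i j r $ k $ l = (if k = i then (if l = j then r else 0)
    else if k = j then (if l = i then - 1 / r else 0) else of_bool (k = l))"
  using assms unfolding weyl_def transv_mult_nth
  by (cases "k = i"; cases "k = j"; cases "l = i"; cases "l = j"; simp add: transv_nth)

lemma weyl_mult_nth:
  assumes "i \<noteq> j" "r \<noteq> 0"
  shows "(weyl i j r ** A) $ k $ l = (if k = i then r * A $ j $ l
    else if k = j then - 1 / r * A $ i $ l else A $ k $ l)"
  using assms unfolding weyl_def matrix_mul_assoc[symmetric] transv_mult_nth
  by (cases "k = i"; cases "k = j"; simp add: algebra_simps)

lemma weyl_in_transv_grp: "i \<noteq> j \<Longrightarrow> weyl i j r \<in> transv_grp"
  by (simp add: weyl_def transv_grp_mult transv_grp_transv)

lemma hyperbolic_in_transv_grp: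
  assumes "i \<noteq> j" "r \<noteq> 0"
  shows "diagm (\<lambda>k. if k = i then r else if k = j then 1 / r else 1) \<in> transv_grp"
proof -
  have "diagm (\<lambda>k. if k = i then r else if k = j then 1 / r else 1) = weyl i j r ** weyl i j (- 1)"
    using assms by (auto simp: vec_eq_iff weyl_mult_nth weyl_nth diagm_nth)
  then show ?thesis using assms(1) by (simp add: transv_grp_mult weyl_in_transv_grp)
qed

text \<open>Induction on a set \<open>S\<close> that contains all indices, apart from a reserved
  \<open>k\<close>, where \<open>d\<close> may differ from 1. A hyperbolic factor clears the entry
  at \<open>x\<close> at the expense of the one at \<open>k\<close>; at the end the determinant
  forces \<open>d k = 1\<close>.\<close>

lemma diagm_in_transv_grp:
  assumes "prod d UNIV = 1" shows "diagm d \<in> transv_grp"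
proof -
  obtain k :: 'a where True by simp
  have "finite S \<Longrightarrow> k \<notin> S \<Longrightarrow> (\<And>i. i \<notin> S \<Longrightarrow> i \<noteq> k \<Longrightarrow> d i = 1) \<Longrightarrow> prod d UNIV = 1
      \<Longrightarrow> diagm d \<in> transv_grp" for S d
  proof (induction S arbitrary: d rule: finite_induct)
    case empty
    then have "prod d UNIV = d k" by (subst prod.remove[of _ k]) auto
    then have "d = (\<lambda>i. 1)" using empty by (metis emptyE)
    then show ?case by (simp add: diagm_one transv_grp.one)
  next
    case (insert x S)
    have nz: "d i \<noteq> 0" for i using insert.prems(3) by (metis UNIV_I finite prod_zero_iff zero_neq_one)
    define e where "e = (\<lambda>i. if i = x then d x else if i = k then 1 / d x else 1)"
    define d' where "d' = (\<lambda>i. d i / e i)"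
    have xk: "x \<noteq> k" using insert by auto
    have e: "diagm e \<in> transv_grp" unfolding e_def using xk nz by (rule hyperbolic_in_transv_grp)
    have enz: "e i \<noteq> 0" for i using nz by (simp add: e_def)
    have "prod e UNIV = 1" using transv_grp_det[OF e] by (simp add: det_diagm)
    then have "prod d' UNIV = 1" using insert.prems(3) by (simp add: d'_def prod_dividef)
    then have "diagm d' \<in> transv_grp"
      using insert.prems nz by (intro insert.IH) (auto simp: d'_def e_def)
    moreover have "diagm d = diagm e ** diagm d'"
      using enz by (simp add: diagm_mult d'_def)
    ultimately show ?case using e by (simp add: transv_grp_mult)
  qed
  from this[of "- {k}" d] assms show ?thesis by simp
qed

text \<open>Elementary matrices need not lie in \<open>SL\<close>, so the induction treats all
  matrices of nonzero determinant and yields a generated matrix times a diagonal one. For a matrix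
  in \<open>SL\<close> the diagonal factor has determinant 1 and is generated too.\<close>

lemma SL_subset_transv_grp:
  assumes "A \<in> SL" shows "A \<in> transv_grp"
proof -
  have "det A \<noteq> 0 \<longrightarrow> (\<exists>E\<in>transv_grp. \<exists>d. (\<forall>i. d i \<noteq> 0) \<and> A = E ** diagm d)" for A :: "real^'a^'a"
  proof (induction A rule: induct_matrix_elementary)
    case (1 A B)
    show ?case
    proof
      assume "det (A ** B) \<noteq> 0"
      then obtain E d E' d' where *: "E \<in> transv_grp" "E' \<in> transv_grp" "\<forall>i. d i \<noteq> 0" "\<forall>i. d' i \<noteq> 0"
        "A = E ** diagm d" "B = E' ** diagm d'"
        using 1 by (auto simp: det_mul)
      obtain E'' where E'': "E'' \<in> transv_grp" "diagm d ** E' = E'' ** diagm d"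
        using diagm_normalizes_transv_grp[OF *(2)] *(3) by metis
      have "A ** B = (E ** E'') ** diagm (\<lambda>i. d i * d' i)"
        using E''(2) by (simp add: *(5,6) flip: diagm_mult) (metis matrix_mul_assoc)
      then show "\<exists>E\<in>transv_grp. \<exists>d. (\<forall>i. d i \<noteq> 0) \<and> A ** B = E ** diagm d"
        using * E'' transv_grp_mult[of E E'']
        by (intro bexI[of _ "E ** E''"] exI[of _ "\<lambda>i. d i * d' i"]) auto
    qed
  next
    case (2 A i)
    then show ?case by (simp add: det_zero_row)
  next
    case (3 A)
    then have "A = diagm (\<lambda>i. A $ i $ i)" by (auto simp: vec_eq_iff diagm_nth)
    moreover have "\<forall>i. A $ i $ i \<noteq> 0" if "det A \<noteq> 0"
      using that 3 by (simp add: det_diagonal)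
    ultimately show ?case
      by (intro impI bexI[OF _ transv_grp.one] exI[of _ "\<lambda>i. A $ i $ i"]) simp
  next
    case (4 m n)
    \<comment> \<open>A transposition matrix has determinant -1, so a sign has to be split off from
      the Weyl element.\<close>
    have "(\<chi> i j. mat 1 $ i $ Transposition.transpose m n j) =
      weyl m n 1 ** diagm (\<lambda>i. if i = m then - 1 else 1)"
      using 4 by (auto simp: vec_eq_iff mult_diagm_nth weyl_nth mat_def Transposition.transpose_def)
    moreover have "\<forall>i. (if i = m then - 1 else 1 :: real) \<noteq> 0" by simp
    ultimately show ?case
      by (intro impI bexI[OF _ weyl_in_transv_grp[OF 4, of 1]] exI[of _ "\<lambda>i. if i = m then - 1 else 1"]) simp
  next
    case (5 m n c)
    have "(\<chi> i j. if i = m \<and> j = n then c else of_bool (i = j)) = transv m n c ** diagm (\<lambda>i. 1)"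
      using 5 by (auto simp: diagm_one vec_eq_iff transv_nth)
    then show ?case using transv_grp_transv[OF 5] by (metis zero_neq_one)
  qed
  then obtain E d where *: "E \<in> transv_grp" "A = E ** diagm d"
    using assms by (metis SL_D zero_neq_one)
  then have "prod d UNIV = 1"
    using assms by (simp add: SL_def det_mul transv_grp_det det_diagm)
  then show ?thesis using * by (simp add: diagm_in_transv_grp transv_grp_mult)
qed

lemma sl_aut_fixing_transv:
  assumes "sl_aut f" "\<And>i j s. i \<noteq> j \<Longrightarrow> f (transv i j s) = transv i j s" "A \<in> SL"
  shows "f A = A"
proof -
  have "A \<in> transv_grp" using assms by (simp add: SL_subset_transv_grp)
  then show ?thesis
  proof induction
    case one
    then show ?case using assms by (simp add: sl_aut_one)
  next
    case (step A i j s)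
    moreover have "A \<in> SL" using step by (simp add: SL_def transv_grp_det)
    ultimately show ?case by (simp add: sl_aut_mult[OF assms(1)] SL_transv assms(2))
  qed
qed

section \<open>Automorphisms that permute the root subgroups through the indices\<close>

text \<open>Nonnegative numbers are squares, so \<open>f\<close> is monotone; it fixes the
  rationals, which are dense. This replaces a continuity assumption on the automorphisms.\<close>

lemma real_ring_hom_id:
  fixes f :: "real \<Rightarrow> real"
  assumes add: "\<And>x y. f (x + y) = f x + f y" and mult: "\<And>x y. f (x * y) = f x * f y"
    and one: "f 1 = 1"
  shows "f x = x"
proof -
  have zero: "f 0 = 0" using add[of 0 0] by simp
  have neg: "f (- x) = - f x" for x using add[of x "- x"] zero by simp
  have nat: "f (of_nat n) = of_nat n" for n
    by (induction n) (simp_all add: zero one add)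
  have int: "f (of_int k) = of_int k" for k
    by (cases k rule: int_diff_cases) (simp add: add neg nat diff_conv_add_uminus del: add_uminus_conv_diff)
  have rat: "f (of_rat q) = of_rat q" for q
  proof (cases q)
    case (Fract a b)
    have "of_rat q * of_int b = (of_int a :: real)"
      using Fract by (simp add: of_rat_rat)
    then have "f (of_rat q) * of_int b = of_int a"
      using mult[of "of_rat q" "of_int b"] by (simp add: int)
    then show ?thesis using Fract by (simp add: of_rat_rat field_simps)
  qed
  have mono: "f x \<le> f y" if "x \<le> y" for x y
  proof -
    have "f (y - x) = f (sqrt (y - x)) * f (sqrt (y - x))"
      using that by (simp flip: mult)
    then have "f (y - x) \<ge> 0" by simp
    then show ?thesis using add[of x "y - x"] by simp
  qed
  show ?thesis
  proof (rule antisym; rule ccontr)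
    assume "\<not> f x \<le> x"
    then obtain q where "x < of_rat q" "of_rat q < f x" using of_rat_dense by (meson not_le)
    then show False using mono[of x "of_rat q"] rat[of q] by simp
  next
    assume "\<not> x \<le> f x"
    then obtain q where "f x < of_rat q" "of_rat q < x" using of_rat_dense by (meson not_le)
    then show False using mono[of "of_rat q" x] rat[of q] by simp
  qed
qed

text \<open>Here \<open>P\<close> ranges over all invertible matrices, not only over
  \<open>SL\<close>, so that rescalings by arbitrary diagonal matrices and permutation matrices of
  determinant -1 are covered.\<close>

definition is_inner :: "(real^'n^'n \<Rightarrow> real^'n^'n) \<Rightarrow> bool" where
  "is_inner f \<longleftrightarrow> (\<exists>P Q. P ** Q = mat 1 \<and> Q ** P = mat 1 \<and> (\<forall>A\<in>SL. f A = P ** A ** Q))"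

lemma inner_conj:
  fixes P :: "real^'n^'n"
  assumes "P ** Q = mat 1" "Q ** P = mat 1" "is_inner (\<lambda>A. P ** f A ** Q)"
  shows "is_inner f"
proof -
  obtain R S where RS: "R ** S = mat 1" "S ** R = mat 1" "\<And>A. A \<in> SL \<Longrightarrow> P ** f A ** Q = R ** A ** S"
    using assms(3) unfolding is_inner_def by blast
  have "f A = (Q ** R) ** A ** (S ** P)" if "A \<in> SL" for A
  proof -
    have "f A = (Q ** P) ** f A ** (Q ** P)" using assms by simp
    also have "\<dots> = Q ** (P ** f A ** Q) ** P" by (simp only: matrix_mul_assoc)
    finally show ?thesis using RS(3)[OF that] by (simp only: matrix_mul_assoc)
  qed
  moreover have QR: "(Q ** R) ** (S ** P) = mat 1"
    by (metis RS(1) assms(2) matrix_mul_assoc matrix_mul_rid)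
  moreover have "(S ** P) ** (Q ** R) = mat 1"
    using QR matrix_left_right_inverse by blast
  ultimately show ?thesis unfolding is_inner_def by blast
qed

text \<open>The parameter maps \<open>g i j\<close> are additive, and multiplicative across three
  roots by the commutator relation. A diagonal conjugation normalizes them at 1; then they are ring
  endomorphisms of the reals, hence the identity, and transvections generate.\<close>

lemma inner_if_transv_fixed_type:
  fixes f :: "real^'n^'n \<Rightarrow> real^'n^'n"
  assumes n: "CARD('n) \<ge> 3" and f: "sl_aut f"
    and g: "\<And>i j s. i \<noteq> j \<Longrightarrow> f (transv i j s) = transv i j (g i j s)"
  shows "is_inner f"
proof -
  have add: "g i j (s + t) = g i j s + g i j t" if "i \<noteq> j" for i j s t
  proof -
    have "f (transv i j s ** transv i j t) = transv i j (g i j s) ** transv i j (g i j t)"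
      using f that by (simp add: sl_aut_mult SL_transv g)
    then show ?thesis using that by (simp add: transv_add g transv_eq_iff)
  qed
  have mult: "g i j s * g j k t = g i k (s * t)" if "i \<noteq> j" "j \<noteq> k" "i \<noteq> k" for i j k s t
  proof -
    have "f (transv i j s ** transv j k t) = f (transv i k (s * t) ** transv j k t ** transv i j s)"
      using that by (simp add: transv_commutator)
    then have "transv i j (g i j s) ** transv j k (g j k t) = 
        transv i k (g i k (s * t)) ** transv j k (g j k t) ** transv i j (g i j s)"
      using f that by (simp add: sl_aut_mult SL_transv g SL_mult)
    then have "transv i k (g i j s * g j k t) ** transv j k (g j k t) ** transv i j (g i j s) = 
        transv i k (g i k (s * t)) ** transv j k (g j k t) ** transv i j (g i j s)"
      using that by (simp add: transv_commutator)
    then show ?thesis using that by (simp add: mult_cancel_r SL_transv transv_eq_iff)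
  qed
  have nz: "g i j 1 \<noteq> 0" if "i \<noteq> j" for i j
  proof
    assume "g i j 1 = 0"
    then have "f (transv i j 1) = f (mat 1)" using g[OF that, of 1] f by (simp add: sl_aut_one)
    then show False using f that by (simp add: sl_aut_inj SL_transv SL_one transv_eq_one_iff)
  qed
  obtain o' :: 'n where True by simp
  \<comment> \<open>Solves \<open>d i * g i o' 1 / d o' = 1\<close> with \<open>d o' = 1\<close>,
    which normalizes the roots ending at \<open>o'\<close>; \<open>dg\<close> extends this to all
    roots.\<close>
  define d where "d i = (if i = o' then 1 else inverse (g i o' 1))" for i
  have dnz: "d i \<noteq> 0" for i using nz by (simp add: d_def)
  have opp: "g i j 1 * g j i 1 = 1" if "i \<noteq> j" for i j
  proof -
    \<comment> \<open>Going from \<open>i\<close> to \<open>j\<close>, back to \<open>i\<close> and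
      on to \<open>k\<close> avoids the pair \<open>(i, i)\<close>, which is not a root.\<close>
    obtain k where "k \<noteq> i" "k \<noteq> j" using ex_third[OF n] by blast
    then have "g i j 1 * (g j i 1 * g i k 1) = g i k 1" 
      using mult[of j i k 1 1] mult[of i j k 1 1] that by simp
    then show ?thesis using nz[of i k] \<open>k \<noteq> i\<close> by (metis mult.assoc mult_cancel_right2)
  qed
  have dg: "d i * g i j 1 / d j = 1" if "i \<noteq> j" for i j
  proof -
    consider "i = o'" | "j = o'" | "i \<noteq> o'" "j \<noteq> o'" by blast
    then show ?thesis
    proof cases
      case 1
      then show ?thesis using opp[OF that] that nz[of j o'] by (simp add: d_def divide_inverse)
    next
      case 2
      then show ?thesis using nz[OF that] that by (simp add: d_def)
    next
      case 3
      then show ?thesis using mult[of i j o' 1 1] nz[of i o'] nz[of j o'] that 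
        by (simp add: d_def field_simps)
    qed
  qed
  define h where "h i j s = d i * g i j s / d j" for i j s
  have h_mult: "h i j s * h j k t = h i k (s * t)" if "i \<noteq> j" "j \<noteq> k" "i \<noteq> k" for i j k s t
    using mult[OF that, of s t] dnz[of j] by (simp add: h_def)
  have h_one: "h i j 1 = 1" if "i \<noteq> j" for i j using dg[OF that] unfolding h_def .
  have h_id: "h i j s = s" if ij: "i \<noteq> j" for i j s
  proof -
    \<comment> \<open>A third index identifies \<open>h i j\<close>, \<open>h i k\<close> and
      \<open>h j k\<close>, which turns the mixed product rule into multiplicativity of a single
      map.\<close>
    obtain k where k: "k \<noteq> i" "k \<noteq> j" using ex_third[OF n] by blast
    have 1: "h i j s = h i k s" for s using h_mult[of i j k s 1] h_one[of j k] k ij by simp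
    have 2: "h j k s = h i k s" for s using h_mult[of i j k 1 s] h_one[of i j] k ij by simp
    have "h i j (s * t) = h i j s * h i j t" for s t
      using h_mult[of i j k s t] 1 2 k ij by simp
    moreover have "h i j (s + t) = h i j s + h i j t" for s t
      using ij by (simp add: h_def add algebra_simps add_divide_distrib)
    ultimately show ?thesis using real_ring_hom_id[of "h i j"] h_one[OF ij] by blast
  qed
  define D where "D = diagm d"
  define D' where "D' = diagm (\<lambda>i. inverse (d i))"
  have DD: "D ** D' = mat 1" "D' ** D = mat 1" 
    unfolding D_def D'_def using diagm_inverse[of d] dnz by simp_all
  have "D ** f A ** D' = A" if "A \<in> SL" for A
  proof (rule sl_aut_fixing_transv[OF _ _ that, of "\<lambda>A. D ** f A ** D'"])
    show "sl_aut (\<lambda>A. D ** f A ** D')" using sl_aut_comp[OF sl_aut_conj[OF DD(1)] f] .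
    fix i j :: 'n and s assume ij: "i \<noteq> j"
    have "D ** f (transv i j s) ** D' = transv i j (h i j s) ** (D ** D')"
      using ij dnz by (simp add: g D_def diagm_transv h_def matrix_mul_assoc)
    then show "D ** f (transv i j s) ** D' = transv i j s" using ij by (simp add: DD h_id)
  qed
  then have "is_inner (\<lambda>A. D ** f A ** D')"
    unfolding is_inner_def by (intro exI[of _ "mat 1"]) simp
  then show ?thesis by (rule inner_conj[OF DD])
qed

text \<open>Conjugation by the permutation matrix of \<open>\<pi>\<close> brings the root
  \<open>(\<pi> i, \<pi> j)\<close> back to \<open>(i, j)\<close>.\<close>

lemma inner_if_transv_permuted:
  fixes f :: "real^'n^'n \<Rightarrow> real^'n^'n" and \<pi> :: "'n \<Rightarrow> 'n"
  assumes n: "CARD('n) \<ge> 3" and f: "sl_aut f" and inj: "inj \<pi>"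
    and g: "\<And>i j s. i \<noteq> j \<Longrightarrow> f (transv i j s) = transv (\<pi> i) (\<pi> j) (g i j s)"
  shows "is_inner f"
proof -
  define P :: "real^'n^'n" where "P = (\<chi> i j. of_bool (j = \<pi> i))"
  define Q :: "real^'n^'n" where "Q = (\<chi> i j. of_bool (i = \<pi> j))"
  have P_mult: "(P ** A) $ i $ j = A $ (\<pi> i) $ j" for A i j
    by (simp add: P_def matrix_matrix_mult_def of_bool_def if_distrib[of "\<lambda>x. x * y" for y] cong: if_cong)
  have mult_Q: "(A ** Q) $ i $ j = A $ i $ (\<pi> j)" for A i j
    by (simp add: Q_def matrix_matrix_mult_def of_bool_def if_distrib[of "\<lambda>x. y * x" for y] cong: if_cong)
  have PQ: "P ** Q = mat 1"
    using inj by (auto simp: vec_eq_iff P_mult) (auto simp: Q_def mat_def inj_eq)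
  have "P ** f (transv i j s) ** Q = transv i j (g i j s)" if "i \<noteq> j" for i j s
    using that inj by (simp add: g vec_eq_iff mult_Q P_mult) (simp add: transv_nth inj_eq)
  then have "is_inner (\<lambda>A. P ** f A ** Q)"
    using inner_if_transv_fixed_type[OF n sl_aut_comp[OF sl_aut_conj[OF PQ] f]] by blast
  then show ?thesis using inner_conj[OF PQ] PQ matrix_left_right_inverse by blast
qed

section \<open>The action on the root subgroups\<close>

text \<open>The root \<open>(i, j)\<close> is mapped to the root \<open>(A i j, B i j)\<close>. Two roots do not commute if and only if
  the column index of one is the row index of the other.\<close>

locale root_map =
  fixes A B :: "'n::finite \<Rightarrow> 'n \<Rightarrow> 'n"
  assumes n: "CARD('n) \<ge> 3"
    and ne: "\<And>i j. i \<noteq> j \<Longrightarrow> A i j \<noteq> B i j"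
    and comm: "\<And>i j k l. i \<noteq> j \<Longrightarrow> k \<noteq> l \<Longrightarrow> B i j = A k l \<or> A i j = B k l \<longleftrightarrow> j = k \<or> i = l"
    and surj: "\<And>a b. a \<noteq> b \<Longrightarrow> \<exists>i j. i \<noteq> j \<and> A i j = a \<and> B i j = b"
begin

text \<open>No root fails to commute with both \<open>(i, j)\<close> and \<open>(j, i)\<close>. If
  their images were, in some order, \<open>(p, q)\<close> and \<open>(q, r)\<close> with
  \<open>r \<noteq> p\<close>, then \<open>(r, p)\<close> would fail to commute with both images,
  and so would its preimage with both roots.\<close>

lemma opposite:
  assumes "i \<noteq> j" shows "A j i = B i j \<and> B j i = A i j"
proof (rule ccontr)
  assume neg: "\<not> ?thesis"
  have "\<exists>a b. a \<noteq> b \<and> (b = A i j \<or> a = B i j) \<and> (b = A j i \<or> a = B j i)"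
    using comm[of i j j i] assms neg by metis
  then obtain a b where ab: "a \<noteq> b" "b = A i j \<or> a = B i j" "b = A j i \<or> a = B j i" by blast
  obtain k l where "k \<noteq> l" "A k l = a" "B k l = b" using surj[OF ab(1)] by blast
  then show False using comm[of k l i j] comm[of k l j i] ab(2,3) assms by auto
qed

text \<open>The root \<open>(k, i)\<close> separates the two: it commutes with \<open>(j, i)\<close>
  but not with \<open>(j, k)\<close>.\<close>

lemma not_same:
  assumes "j \<noteq> k" "i \<noteq> j" "i \<noteq> k"
  shows "\<not> (A j k = A j i \<and> B j k = B j i)"
  using comm[of j k k i] comm[of j i k i] assms by auto

text \<open>By \<open>comm\<close>, the images of \<open>(i, j)\<close> and \<open>(j, k)\<close>
  are composable in one of two orders; here the order is kept for every third index. The reversed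
  order is the same notion with \<open>A\<close> and \<open>B\<close> exchanged.\<close>

definition direct :: "'n \<Rightarrow> 'n \<Rightarrow> bool" where
  "direct i j \<longleftrightarrow> (\<forall>k. k \<noteq> i \<longrightarrow> k \<noteq> j \<longrightarrow> B i j = A j k)"

text \<open>One witness decides the order: if another index \<open>k'\<close> reversed it, comparing
  \<open>(k, j)\<close> with \<open>(j, k')\<close> would give \<open>(j, k)\<close> and
  \<open>(j, i)\<close> the same image, against \<open>not_same\<close>.\<close>

lemma directI:
  assumes "i \<noteq> j" "i \<noteq> k" "j \<noteq> k" "B i j = A j k" shows "direct i j"
  unfolding direct_def
proof (intro allI impI)
  fix k' assume k': "k' \<noteq> i" "k' \<noteq> j"
  show "B i j = A j k'"
  proof (rule ccontr)
    assume neg: "B i j \<noteq> A j k'"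
    then have 1: "A i j = B j k'" using comm[of i j j k'] assms k' by auto
    have "A k j = B j k' \<or> B k j = A j k'" using comm[of k j j k'] assms k' by auto
    then have "B j k = A i j" using opposite[of j k] assms 1 neg by auto
    then show False using not_same[of j k i] opposite[of i j] assms by auto
  qed
qed

text \<open>In the cycle \<open>(i, j)\<close>, \<open>(j, k)\<close>, \<open>(k, i)\<close>
  consecutive roots do not commute. Reversing the order at \<open>k\<close> would make
  \<open>B k i\<close> equal to \<open>B i j\<close>, and then \<open>(k, i)\<close> and
  \<open>(i, j)\<close> could fail to commute only if one of their images had equal indices.\<close>

lemma direct_next:
  assumes "direct i j" "i \<noteq> j" "k \<noteq> i" "k \<noteq> j" shows "direct j k"
proof (rule directI[of j k i])
  have 1: "B i j = A j k" using assms by (auto simp: direct_def)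
  have "B j k = A k i \<or> A j k = B k i" using comm[of j k k i] assms by auto
  then show "B j k = A k i" using comm[of i j k i] ne[of i j] ne[of k i] assms 1 by metis
qed (use assms in auto)

lemma direct_row:
  assumes "direct i j" "i \<noteq> j" "k \<noteq> i" "k \<noteq> j" shows "A i j = A i k"
proof -
  have "direct k i" using direct_next[of j k i] direct_next[of i j k] assms by auto
  then have "B k i = A i j" using assms by (auto simp: direct_def)
  then show ?thesis using opposite[of i k] assms by auto
qed

lemma direct_swap:
  assumes "direct i j" "i \<noteq> j" shows "direct j i"
proof -
  obtain k where k: "k \<noteq> i" "k \<noteq> j" using ex_third[OF n] by blast
  show ?thesis
    using direct_row[of i j k] opposite[of i j] assms k by (intro directI[of j i k]) auto
qed

lemma direct_all:
  assumes "direct i j" "i \<noteq> j" "k \<noteq> l" shows "direct k l"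
proof -
  have 1: "direct j k" if "k \<noteq> j" for k
    using direct_next[of i j k] direct_swap[of i j] assms that by metis
  have 2: "direct k j" if "k \<noteq> j" for k
    using direct_swap[OF 1] that by auto
  show ?thesis
    using direct_next[of j k l] 1[of k] 1[of l] 2[of k] assms by metis
qed

lemma direct_imp_permutation:
  assumes "direct i0 j0" "i0 \<noteq> j0"
  shows "\<exists>\<pi>. inj \<pi> \<and> (\<forall>i j. i \<noteq> j \<longrightarrow> A i j = \<pi> i \<and> B i j = \<pi> j)"
proof -
  \<comment> \<open>Any second index will do, since by \<open>direct_row\<close> the value
    \<open>A i j\<close> does not depend on \<open>j\<close>.\<close>
  define \<pi> where "\<pi> i = A i (SOME j. j \<noteq> i)" for i
  have \<pi>: "A i j = \<pi> i" if "i \<noteq> j" for i j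
  proof -
    have "(SOME j. j \<noteq> i) \<noteq> i" by (rule someI[of _ j]) (use that in auto)
    then show ?thesis unfolding \<pi>_def using direct_row direct_all[OF assms] that by metis
  qed
  have "B i j = \<pi> j" if "i \<noteq> j" for i j
    using opposite[of i j] \<pi>[of j i] that by auto
  moreover have "inj \<pi>" using ne \<pi> calculation by (metis injI)
  ultimately show ?thesis using \<pi> by blast
qed

text \<open>The hypotheses are symmetric in \<open>A\<close> and \<open>B\<close>, so the
  order-reversing case, which the contragredient produces, follows from the order-preserving
  one.\<close>

lemma swapped: "root_map B A"
proof
  fix a b :: 'n assume "a \<noteq> b"
  then show "\<exists>i j. i \<noteq> j \<and> B i j = a \<and> A i j = b" using surj[of b a] by blast
next
  fix i j k l :: 'n assume "i \<noteq> j" "k \<noteq> l"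
  then show "A i j = B k l \<or> B i j = A k l \<longleftrightarrow> j = k \<or> i = l" using comm[of i j k l] by blast
qed (use n ne in \<open>auto simp: eq_commute\<close>)

lemma permutation:
  "\<exists>\<pi>. inj \<pi> \<and> ((\<forall>i j. i \<noteq> j \<longrightarrow> A i j = \<pi> i \<and> B i j = \<pi> j)
    \<or> (\<forall>i j. i \<noteq> j \<longrightarrow> A i j = \<pi> j \<and> B i j = \<pi> i))"
proof -
  interpret sw: root_map B A by (rule swapped)
  obtain i :: 'n where True by simp
  obtain j where j: "j \<noteq> i" using ex_third[OF n] by blast
  obtain k where k: "k \<noteq> i" "k \<noteq> j" using ex_third[OF n] by blast
  have "B i j = A j k \<or> A i j = B j k" using comm[of i j j k] j k by auto
  then consider "direct i j" | "sw.direct i j"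
    using directI[of i j k] sw.directI[of i j k] j k by auto
  then show ?thesis
  proof cases
    case 1
    then show ?thesis using direct_imp_permutation j by blast
  next
    case 2
    then show ?thesis using sw.direct_imp_permutation[of i j] j by blast
  qed
qed

end

section \<open>Images of root subgroups when the diagonal torus is preserved\<close>

text \<open>Scalars cancel in a conjugation, so a positive diagonal matrix may be replaced by one of
  determinant 1 that acts in the same way.\<close>

lemma scale_to_SL:
  fixes e :: "'n::finite \<Rightarrow> real"
  assumes "\<And>i. e i > 0"
  shows "\<exists>c>0. prod (\<lambda>i. c * e i) UNIV = 1"
proof -
  define c where "c = root CARD('n) (inverse (prod e UNIV))"
  have p: "prod e UNIV > 0" using assms by (simp add: prod_pos)
  then have "c > 0" by (simp add: c_def)
  moreover have "c ^ CARD('n) = inverse (prod e UNIV)"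
    using p by (simp add: c_def)
  then have "prod (\<lambda>i. c * e i) UNIV = 1"
    using left_inverse[of "prod e UNIV"] p
    by (simp only: prod.distrib prod_constant less_irrefl)
  ultimately show ?thesis by blast
qed

lemma nonzero_of_prod_one:
  fixes d :: "'n::finite \<Rightarrow> real"
  shows "prod d UNIV = 1 \<Longrightarrow> d i \<noteq> 0"
  by (metis UNIV_I finite prod_zero_iff zero_neq_one)

lemma sum_single:
  fixes g :: "'n::finite \<Rightarrow> real"
  assumes "\<And>m. m \<noteq> k \<Longrightarrow> g m = 0" shows "sum g UNIV = g k"
  using assms by (subst sum.remove[of _ k]) auto

lemma sum_pair:
  fixes g :: "'n::finite \<Rightarrow> real"
  assumes "k \<noteq> l" "\<And>m. m \<noteq> k \<Longrightarrow> m \<noteq> l \<Longrightarrow> g m = 0" shows "sum g UNIV = g k + g l"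
proof -
  have "sum g UNIV = g k + sum g (UNIV - {k})" by (rule sum.remove) auto
  also have "sum g (UNIV - {k}) = g l + sum g (UNIV - {k} - {l})"
    using assms(1) by (intro sum.remove) auto
  also have "sum g (UNIV - {k} - {l}) = 0" using assms(2) by (intro sum.neutral) auto
  finally show ?thesis by simp
qed

text \<open>The hypothesis says that all conjugates of \<open>u\<close> by positive diagonal matrices commute with \<open>u\<close>.
  Conjugating by a matrix that differs from the identity in one entry isolates a single product.\<close>

lemma entry_product_zero:
  fixes u :: "real^'n^'n"
  assumes "\<And>e. (\<And>i. e i > 0) \<Longrightarrow> \<exists>v. u ** v = v ** u \<and> (\<forall>k l. v $ k $ l = e k * u $ k $ l / e l)"
    and k: "k \<noteq> i" "k \<noteq> l"
  shows "u $ i $ k * u $ k $ l = 0"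
proof -
  define e :: "'n \<Rightarrow> real" where "e = (\<lambda>i. if i = k then 2 else 1)"
  obtain v where v: "u ** v = v ** u" "\<And>p q. v $ p $ q = e p * u $ p $ q / e q"
  proof -
    have "e i > 0" for i by (simp add: e_def)
    then show ?thesis using assms(1)[of e] that by blast
  qed
  have "0 = (u ** v - v ** u) $ i $ l" using v(1) by simp
  also have "\<dots> = (\<Sum>m\<in>UNIV. u $ i $ m * v $ m $ l - v $ i $ m * u $ m $ l)"
    by (simp add: matrix_matrix_mult_def sum_subtractf)
  also have "\<dots> = u $ i $ k * v $ k $ l - v $ i $ k * u $ k $ l"
    by (rule sum_single) (use k in \<open>simp add: v(2) e_def\<close>)
  \<comment> \<open>The entry \<open>v $ k $ l\<close> is doubled and \<open>v $ i $ k\<close> is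
    halved, whence \<open>2 - 1 / 2\<close>.\<close>
  also have "\<dots> = u $ i $ k * u $ k $ l * (3 / 2)"
    using k by (simp add: v(2) e_def)
  finally show ?thesis by simp
qed

text \<open>In the \<open>(i, l)\<close> entry of the commutator, products through other indices
  vanish by \<open>entry_product_zero\<close>, so only the terms at \<open>i\<close> and
  \<open>l\<close> remain.\<close>

lemma entry_diagonal_eq:
  fixes u :: "real^'n^'n"
  assumes "\<And>e. (\<And>i. e i > 0) \<Longrightarrow> \<exists>v. u ** v = v ** u \<and> (\<forall>k l. v $ k $ l = e k * u $ k $ l / e l)"
    and il: "i \<noteq> l"
  shows "u $ i $ l * (u $ i $ i - u $ l $ l) = 0"
proof -
  define e :: "'n \<Rightarrow> real" where "e = (\<lambda>k. if k = i then 2 else 1)"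
  obtain v where v: "u ** v = v ** u" "\<And>p q. v $ p $ q = e p * u $ p $ q / e q"
  proof -
    have "e i > 0" for i by (simp add: e_def)
    then show ?thesis using assms(1)[of e] that by blast
  qed
  have z: "u $ i $ m * u $ m $ l = 0" if "m \<noteq> i" "m \<noteq> l" for m
    using entry_product_zero[OF assms(1) that] .
  have "0 = (u ** v - v ** u) $ i $ l" using v(1) by simp
  also have "\<dots> = (\<Sum>m\<in>UNIV. u $ i $ m * v $ m $ l - v $ i $ m * u $ m $ l)"
    by (simp add: matrix_matrix_mult_def sum_subtractf)
  also have "\<dots> = (u $ i $ i * v $ i $ l - v $ i $ i * u $ i $ l) + (u $ i $ l * v $ l $ l - v $ i $ l * u $ l $ l)"
    by (rule sum_pair[OF il]) (use z il in \<open>auto simp: v(2) e_def\<close>)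
  also have "\<dots> = u $ i $ l * (u $ i $ i - u $ l $ l)"
    using il by (simp add: v(2) e_def algebra_simps)
  finally show ?thesis by simp
qed

text \<open>The image \<open>U\<close> of the root subgroup is commutative, contains the positive
  diagonal conjugates of \<open>u\<close>, and apart from the identity consists of diagonal
  conjugates of \<open>u\<close>. Commutativity kills most products of entries of \<open>u\<close>;
  the two conjugacy properties then make the diagonal 1 and leave a single other entry.\<close>

lemma transv_image:
  fixes f :: "real^'n^'n \<Rightarrow> real^'n^'n"
  assumes n: "CARD('n) \<ge> 3" and f: "sl_aut f"
    and diag: "\<And>A. A \<in> SL \<Longrightarrow> (\<exists>d. f A = diagm d) \<longleftrightarrow> (\<exists>d. A = diagm d)"
    and ij: "i \<noteq> j"
  shows "\<exists>a b. a \<noteq> b \<and> (\<forall>s. \<exists>s'. f (transv i j s) = transv a b s')"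
proof -
  define U where "U s = f (transv i j s)" for s
  define u where "u = U 1"
  have U_SL: "U s \<in> SL" for s using ij by (simp add: U_def sl_aut_in[OF f] SL_transv)
  have U_add: "U s ** U t = U (s + t)" for s t
    using ij by (simp add: U_def SL_transv transv_add flip: sl_aut_mult[OF f])
  have U_inj: "U s = U t \<longleftrightarrow> s = t" for s t
    using ij by (simp add: U_def SL_transv sl_aut_inj[OF f] transv_eq_iff)
  have U0: "U 0 = mat 1" by (simp add: U_def sl_aut_one[OF f])
  \<comment> \<open>Up to a scalar, the positive diagonal matrix is the image of some
    \<open>diagm d\<close>, which rescales the parameter of the root subgroup by
    \<open>d i / d j\<close>.\<close>
  have orbit: "\<exists>s. \<forall>k l. U s $ k $ l = e k * u $ k $ l / e l" if e: "\<forall>i. e i > 0" for e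
  proof -
    have "\<exists>c>0. prod (\<lambda>i. c * e i) UNIV = 1" by (rule scale_to_SL) (simp add: e)
    then obtain c where c: "c > 0" "prod (\<lambda>i. c * e i) UNIV = 1" by blast
    then have "diagm (\<lambda>i. c * e i) \<in> SL" by (simp only: SL_diagm)
    then obtain t where t: "t \<in> SL" "f t = diagm (\<lambda>i. c * e i)" using sl_aut_surj[OF f] by blast
    then obtain d where d: "t = diagm d" using diag by blast
    have dnz: "d k \<noteq> 0" for k using t(1) unfolding d SL_diagm by (rule nonzero_of_prod_one)
    have "f (t ** transv i j 1) = f (transv i j (d i * 1 / d j) ** t)"
      unfolding d by (simp add: diagm_transv dnz)
    then have "diagm (\<lambda>i. c * e i) ** u = U (d i / d j) ** diagm (\<lambda>i. c * e i)"
      using t ij by (simp add: sl_aut_mult[OF f] SL_transv u_def U_def)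
    then have "c * e k * u $ k $ l = U (d i / d j) $ k $ l * (c * e l)" for k l
      by (metis diagm_mult_nth mult_diagm_nth)
    then have "U (d i / d j) $ k $ l = e k * u $ k $ l / e l" for k l
      using c(1) spec[OF e, of l] by (simp add: field_simps)
    then show ?thesis by blast
  qed
  have conj: "\<exists>d. (\<forall>k. d k \<noteq> 0) \<and> (\<forall>k l. U s $ k $ l = d k * u $ k $ l / d l)" if s: "s \<noteq> 0" for s
  proof -
    obtain m where m: "m \<noteq> i" "m \<noteq> j" using ex_third[OF n] by blast
    \<comment> \<open>Conjugation by \<open>diagm e\<close> turns the parameter 1 into
      \<open>s\<close>; the third index \<open>m\<close> restores the determinant.\<close>
    define e where "e k = (if k = i then s else if k = m then 1 / s else 1)" for k
    have e_SL: "diagm e \<in> SL"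
      using transv_grp_det[OF hyperbolic_in_transv_grp[of i m s]] m s by (simp add: SL_def e_def[abs_def])
    then obtain d where d: "f (diagm e) = diagm d" using diag by blast
    have dnz: "d k \<noteq> 0" for k
      using sl_aut_in[OF f e_SL] unfolding d SL_diagm by (rule nonzero_of_prod_one)
    have enz: "e k \<noteq> 0" for k using s by (simp add: e_def)
    have "f (diagm e ** transv i j 1) = f (transv i j (e i * 1 / e j) ** diagm e)"
      by (simp add: diagm_transv enz)
    also have "e i * 1 / e j = s" using ij m by (simp add: e_def)
    finally have "diagm d ** u = U s ** diagm d"
      using e_SL ij d by (simp add: sl_aut_mult[OF f] SL_transv u_def U_def)
    then have "d k * u $ k $ l = U s $ k $ l * d l" for k l
      by (metis diagm_mult_nth mult_diagm_nth)
    then show ?thesis using dnz by (intro exI[of _ d]) (simp add: field_simps)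
  qed
  have comm: "\<exists>v. u ** v = v ** u \<and> (\<forall>k l. v $ k $ l = e k * u $ k $ l / e l)"
    if e: "\<And>i. e i > 0" for e
  proof -
    have "\<forall>i. e i > 0" using e by simp
    then obtain s where "\<forall>k l. U s $ k $ l = e k * u $ k $ l / e l" using orbit by blast
    moreover have "u ** U s = U s ** u" by (simp add: u_def U_add add.commute)
    ultimately show ?thesis by blast
  qed
  have path: "u $ k $ m * u $ m $ l = 0" if "m \<noteq> k" "m \<noteq> l" for k l m
    using entry_product_zero[OF comm that] .
  have diag_eq: "u $ k $ l * (u $ k $ k - u $ l $ l) = 0" if "k \<noteq> l" for k l
    using entry_diagonal_eq[OF comm that] .
  have sq_diag: "(u ** u) $ k $ k = u $ k $ k * u $ k $ k" for k
    unfolding matrix_matrix_mult_def using path by (simp add: sum_single[of k])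
  have sq_off: "(u ** u) $ k $ l = u $ k $ l * (u $ k $ k + u $ l $ l)" if "k \<noteq> l" for k l
    unfolding matrix_matrix_mult_def using path that by (simp add: sum_pair[of k l] algebra_simps)
  \<comment> \<open>As a diagonal conjugate of \<open>u\<close>, the matrix
    \<open>U 2 = u ** u\<close> has the same diagonal, while \<open>sq_diag\<close> squares
    it.\<close>
  have diag01: "u $ k $ k = 0 \<or> u $ k $ k = 1" for k
  proof -
    have "(2 :: real) \<noteq> 0" by simp
    then obtain d where "\<forall>k. d k \<noteq> 0" "\<forall>k l. U 2 $ k $ l = d k * u $ k $ l / d l" using conj by blast
    then have "U 2 $ k $ k = u $ k $ k" by simp
    moreover have "u ** u = U 2" by (simp add: u_def U_add)
    ultimately have "u $ k $ k * u $ k $ k = u $ k $ k" using sq_diag[of k] by simp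
    then show ?thesis by simp
  qed
  have diag1: "u $ k $ k = 1" for k
  proof (rule ccontr)
    assume "u $ k $ k \<noteq> 1"
    then have 0: "u $ k $ k = 0" using diag01 by blast
    \<comment> \<open>A zero on the diagonal would make column \<open>k\<close> of the invertible
      matrix \<open>u ** u\<close> vanish.\<close>
    have "(u ** u) $ l $ k = 0" for l
      using sq_diag[of k] sq_off[of l k] diag_eq[of l k] 0 by (cases "l = k") auto
    then have "column k (u ** u) = 0" by (simp add: column_def vec_eq_iff)
    then have "det (u ** u) = 0" by (rule det_zero_column)
    then show False using U_SL[of 1] by (simp add: u_def det_mul SL_def)
  qed
  have "u \<noteq> mat 1" using U_inj[of 1 0] by (simp add: u_def U0)
  then obtain a b where ab: "u $ a $ b \<noteq> mat 1 $ a $ b" by (auto simp: vec_eq_iff)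
  then have "a \<noteq> b" using diag1 by (auto simp: mat_def)
  then have uab: "u $ a $ b \<noteq> 0" using ab by (simp add: mat_def)
  \<comment> \<open>A second nonzero off-diagonal entry has an index \<open>m\<close> outside
    \<open>{a, b}\<close>. Scaling by 2 at \<open>m\<close> gives some \<open>U s\<close> different
    from \<open>u\<close> with the same \<open>(a, b)\<close> entry; then \<open>U (s - 1)\<close>
    has entry 0 there, although it is a diagonal conjugate of \<open>u\<close>.\<close>
  have single: "u $ k $ l = 0" if kl: "k \<noteq> l" "(k, l) \<noteq> (a, b)" for k l
  proof (rule ccontr)
    assume ukl: "u $ k $ l \<noteq> 0"
    have ba: "(k, l) \<noteq> (b, a)" using path[of b a a] ukl uab \<open>a \<noteq> b\<close> by auto
    have "k \<noteq> a \<and> k \<noteq> b \<or> l \<noteq> a \<and> l \<noteq> b" using kl ba by auto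
    then obtain m where m: "m \<noteq> a" "m \<noteq> b" "m = k \<or> m = l" by blast
    define e where "e i = (if i = m then 2 else 1 :: real)" for i
    have "\<forall>i. e i > 0" by (simp add: e_def)
    then obtain s where s: "\<And>k l. U s $ k $ l = e k * u $ k $ l / e l"
      using orbit by blast
    have "U s \<noteq> U 1"
    proof
      assume "U s = U 1"
      then show False using s[of k l] ukl m(3) kl(1) by (auto simp: e_def simp flip: u_def)
    qed
    then have "s - 1 \<noteq> 0" by auto
    then obtain d where d: "\<And>k. d k \<noteq> 0" "\<And>k l. U (s - 1) $ k $ l = d k * u $ k $ l / d l"
      using conj by blast
    have "U (s - 1) ** u = U s" by (simp add: u_def U_add)
    moreover have "(U (s - 1) ** u) $ a $ b = U (s - 1) $ a $ a * u $ a $ b + U (s - 1) $ a $ b * u $ b $ b"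
      unfolding matrix_matrix_mult_def using \<open>a \<noteq> b\<close> path[of _ a b] by (simp add: sum_pair[of a b] d(2))
    moreover have "U s $ a $ b = u $ a $ b" using m s[of a b] by (simp add: e_def)
    ultimately have "U (s - 1) $ a $ b = 0" using d diag1 by simp
    then show False using d uab by simp
  qed
  have "\<exists>s'. f (transv i j s) = transv a b s'" for s
  proof (cases "s = 0")
    case True
    then show ?thesis by (intro exI[of _ 0]) (simp add: sl_aut_one[OF f])
  next
    case False
    then obtain d where d: "\<And>k. d k \<noteq> 0" "\<And>k l. U s $ k $ l = d k * u $ k $ l / d l"
      using conj by blast
    have "U s $ k $ l = transv a b (d a * u $ a $ b / d b) $ k $ l" for k l
      using single[of k l] diag1 d \<open>a \<noteq> b\<close> by (auto simp: transv_nth)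
    then have "U s = transv a b (d a * u $ a $ b / d b)" by (simp add: vec_eq_iff)
    then show ?thesis unfolding U_def by blast
  qed
  then show ?thesis using \<open>a \<noteq> b\<close> by blast
qed

section \<open>Automorphisms of the special linear group\<close>

lemma commute_image_iff:
  assumes "sl_aut f" "A \<in> SL" "B \<in> SL"
  shows "f A ** f B = f B ** f A \<longleftrightarrow> A ** B = B ** A"
  using assms by (simp add: sl_aut_inj[OF assms(1)] SL_mult flip: sl_aut_mult[OF assms(1)])

lemma transv_eq_imp:
  assumes "a \<noteq> b" "s \<noteq> 0" "transv a b s = transv c d t"
  shows "a = c \<and> b = d"
  using arg_cong[OF assms(3), of "\<lambda>M. M $ a $ b"] assms(1,2) by (auto simp: transv_nth split: if_splits)

text \<open>By \<open>transv_image\<close> roots go to roots, and preservation of commutation turns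
  this into a \<open>root_map\<close>. Its two cases are the two alternatives of the
  conclusion.\<close>

lemma inner_or_contragredient_if_diagonal_preserved:
  fixes f :: "real^'n^'n \<Rightarrow> real^'n^'n"
  assumes n: "CARD('n) \<ge> 3" and f: "sl_aut f"
    and diag: "\<And>A. A \<in> SL \<Longrightarrow> (\<exists>d. f A = diagm d) \<longleftrightarrow> (\<exists>d. A = diagm d)"
  shows "is_inner f \<or> is_inner (\<lambda>A. f (contragredient A))"
proof -
  have "\<forall>i j. \<exists>p. i \<noteq> j \<longrightarrow> fst p \<noteq> snd p \<and> (\<forall>s. \<exists>s'. f (transv i j s) = transv (fst p) (snd p) s')"
    using transv_image[OF n f diag] by (metis fst_conv snd_conv)
  then obtain \<sigma> where \<sigma>: "\<And>i j. i \<noteq> j \<Longrightarrow> fst (\<sigma> i j) \<noteq> snd (\<sigma> i j)"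
      "\<And>i j. i \<noteq> j \<Longrightarrow> \<forall>s. \<exists>s'. f (transv i j s) = transv (fst (\<sigma> i j)) (snd (\<sigma> i j)) s'"
    by metis
  define A where "A i j = fst (\<sigma> i j)" for i j
  define B where "B i j = snd (\<sigma> i j)" for i j
  have ne: "A i j \<noteq> B i j" if "i \<noteq> j" for i j using \<sigma>(1) that by (simp add: A_def B_def)
  have "\<forall>i j s. \<exists>s'. i \<noteq> j \<longrightarrow> f (transv i j s) = transv (A i j) (B i j) s'"
    using \<sigma>(2) by (auto simp: A_def B_def)
  then obtain g where g: "\<And>i j s. i \<noteq> j \<Longrightarrow> f (transv i j s) = transv (A i j) (B i j) (g i j s)"
    by metis
  have gnz: "g i j 1 \<noteq> 0" if "i \<noteq> j" for i j
  proof
    assume "g i j 1 = 0"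
    then have "f (transv i j 1) = f (mat 1)" using g[OF that, of 1] by (simp add: sl_aut_one[OF f])
    then show False using that by (simp add: sl_aut_inj[OF f] SL_transv SL_one transv_eq_one_iff)
  qed
  have "root_map A B"
  proof
    show "CARD('n) \<ge> 3" by (rule n)
    show "A i j \<noteq> B i j" if "i \<noteq> j" for i j using ne that .
    show "B i j = A k l \<or> A i j = B k l \<longleftrightarrow> j = k \<or> i = l" if "i \<noteq> j" "k \<noteq> l" for i j k l
    proof -
      have "f (transv i j 1) ** f (transv k l 1) = f (transv k l 1) ** f (transv i j 1) \<longleftrightarrow> j \<noteq> k \<and> i \<noteq> l"
        using that by (simp add: commute_image_iff[OF f] SL_transv transv_commute_iff)
      moreover have "f (transv i j 1) ** f (transv k l 1) = f (transv k l 1) ** f (transv i j 1)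
          \<longleftrightarrow> B i j \<noteq> A k l \<and> A i j \<noteq> B k l"
        using that by (simp add: g transv_commute_iff ne gnz)
      ultimately show ?thesis by blast
    qed
    show "\<exists>i j. i \<noteq> j \<and> A i j = a \<and> B i j = b" if ab: "a \<noteq> b" for a b
    proof -
      \<comment> \<open>The inverse also preserves the diagonal matrices, so it too sends root
        subgroups into root subgroups; this gives surjectivity on roots.\<close>
      let ?h = "inv_into SL f"
      have h: "sl_aut ?h" using sl_aut_inv_into[OF f] .
      have fh: "f (?h X) = X" if "X \<in> SL" for X
        using f that by (metis sl_aut_def bij_betw_inv_into_right)
      have "(\<exists>d. ?h X = diagm d) \<longleftrightarrow> (\<exists>d. X = diagm d)" if X: "X \<in> SL" for X
        using diag[OF sl_aut_in[OF h X]] fh[OF X] by simp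
      then obtain i j where ij: "i \<noteq> j" "\<forall>s. \<exists>s'. ?h (transv a b s) = transv i j s'"
        using transv_image[OF n h _ ab] by blast
      then obtain s' where "?h (transv a b 1) = transv i j s'" by blast
      then have "transv a b 1 = transv (A i j) (B i j) (g i j s')"
        using fh[OF SL_transv[OF ab, of 1]] g[OF ij(1)] by simp
      then show ?thesis using transv_eq_imp[OF ab, of 1] ij(1) by (metis zero_neq_one)
    qed
  qed
  then obtain \<pi> where \<pi>: "inj \<pi>" "(\<forall>i j. i \<noteq> j \<longrightarrow> A i j = \<pi> i \<and> B i j = \<pi> j)
    \<or> (\<forall>i j. i \<noteq> j \<longrightarrow> A i j = \<pi> j \<and> B i j = \<pi> i)"
    using root_map.permutation by blast
  from \<pi>(2) show ?thesis
  proof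
    assume "\<forall>i j. i \<noteq> j \<longrightarrow> A i j = \<pi> i \<and> B i j = \<pi> j"
    then have "f (transv i j s) = transv (\<pi> i) (\<pi> j) (g i j s)" if "i \<noteq> j" for i j s
      using g that by simp
    then show ?thesis using inner_if_transv_permuted[OF n f \<pi>(1)] by blast
  next
    assume *: "\<forall>i j. i \<noteq> j \<longrightarrow> A i j = \<pi> j \<and> B i j = \<pi> i"
    \<comment> \<open>The contragredient exchanges the row and the column of a root and so undoes
      the reversal.\<close>
    have "f (contragredient (transv i j s)) = transv (\<pi> i) (\<pi> j) (g j i (- s))" if "i \<noteq> j" for i j s
      using * that g[of j i "- s"] by (simp add: contragredient_transv)
    with inner_if_transv_permuted[OF n sl_aut_comp[OF f sl_aut_contragredient] \<pi>(1)]
    have "is_inner (\<lambda>A. f (contragredient A))" .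
    then show ?thesis ..
  qed
qed

section \<open>Reduction to automorphisms that preserve the diagonal torus\<close>

text \<open>An involution \<open>g\<close> splits \<open>v\<close> into the halves of
  \<open>v + g v\<close> and \<open>v - g v\<close>, each zero or an eigenvector of
  \<open>g\<close>; a matrix commuting with \<open>g\<close> that scales \<open>v\<close> scales
  both by the same factor.\<close>

lemma span_common_eigenvectors:
  fixes F :: "(real^'n^'n) set"
  assumes "finite F" "\<And>g. g \<in> F \<Longrightarrow> g ** g = mat 1"
    "\<And>g h. g \<in> F \<Longrightarrow> h \<in> F \<Longrightarrow> g ** h = h ** g"
  shows "span {v. \<forall>g\<in>F. \<exists>c. g *v v = c *\<^sub>R v} = UNIV"
  using assms
proof (induction F rule: finite_induct)
  case empty
  then show ?case by simp
next
  case (insert g F)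
  let ?E = "{v. \<forall>h\<in>F. \<exists>c. h *v v = c *\<^sub>R v}"
  let ?E' = "{v. \<forall>h\<in>insert g F. \<exists>c. h *v v = c *\<^sub>R v}"
  have "?E \<subseteq> span ?E'"
  proof
    fix v assume v: "v \<in> ?E"
    have gg: "g *v (g *v v) = v" using insert.prems(1)[of g] by (simp add: matrix_vector_mul_assoc)
    have *: "v + s *\<^sub>R (g *v v) \<in> ?E'" if s: "s = 1 \<or> s = - 1" for s
    proof (rule CollectI, rule ballI)
      fix h assume "h \<in> insert g F"
      then consider "h = g" | "h \<in> F" by blast
      then show "\<exists>c. h *v (v + s *\<^sub>R (g *v v)) = c *\<^sub>R (v + s *\<^sub>R (g *v v))"
      proof cases
        case 1
        then have "h *v (v + s *\<^sub>R (g *v v)) = s *\<^sub>R (v + s *\<^sub>R (g *v v))"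
          using s by (auto simp: matrix_vector_right_distrib matrix_vector_mult_scaleR gg
              matrix_vector_mult_diff_distrib)
        then show ?thesis ..
      next
        case 2
        then obtain c where c: "h *v v = c *\<^sub>R v" using v by blast
        have "h *v (g *v v) = g *v (h *v v)"
          using insert.prems(2)[of h g] 2 by (simp add: matrix_vector_mul_assoc)
        also have "\<dots> = c *\<^sub>R (g *v v)" by (simp add: c matrix_vector_mult_scaleR)
        finally have "h *v (v + s *\<^sub>R (g *v v)) = c *\<^sub>R (v + s *\<^sub>R (g *v v))"
          by (simp add: matrix_vector_right_distrib matrix_vector_mult_scaleR c scaleR_add_right)
        then show ?thesis ..
      qed
    qed
    have "v = (1/2) *\<^sub>R (v + 1 *\<^sub>R (g *v v)) + (1/2) *\<^sub>R (v + (- 1) *\<^sub>R (g *v v))"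
      by (simp add: vec_eq_iff field_simps)
    also have "\<dots> \<in> span ?E'"
      by (intro span_add span_scale span_base *) auto
    finally show "v \<in> span ?E'" .
  qed
  then have "span ?E \<subseteq> span ?E'" by (simp add: span_minimal)
  moreover have "span ?E = UNIV" using insert by simp
  ultimately show ?case by auto
qed

lemma commuting_involutions_diagonalizable:
  fixes F :: "(real^'n^'n) set"
  assumes "finite F" "\<And>g. g \<in> F \<Longrightarrow> g ** g = mat 1"
    "\<And>g h. g \<in> F \<Longrightarrow> h \<in> F \<Longrightarrow> g ** h = h ** g"
  shows "\<exists>(P :: real^'n^'n) Q. P ** Q = mat 1 \<and> Q ** P = mat 1 \<and> (\<forall>g\<in>F. \<exists>e. Q ** g ** P = diagm e)"
proof -
  define E where "E = {v. \<forall>g\<in>F. \<exists>c. g *v v = c *\<^sub>R v}"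
  have E: "span E = UNIV" unfolding E_def by (rule span_common_eigenvectors[OF assms])
  obtain B where B: "B \<subseteq> E" "independent B" "E \<subseteq> span B" "card B = dim E"
    using basis_exists[of E] by blast
  have spB: "span B = UNIV" using B(3) E by (metis span_mono span_span top.extremum_unique)
  have "dim E = CARD('n)" by (metis E dim_span dim_UNIV DIM_cart DIM_real mult.right_neutral)
  then obtain \<beta> where \<beta>: "bij_betw \<beta> (UNIV :: 'n set) B"
    using B(4) finite_same_card_bij[of "UNIV :: 'n set" B] independent_imp_finite[OF B(2)] by auto
  define P :: "real^'n^'n" where "P = (\<chi> i j. \<beta> j $ i)"
  have col: "column j P = \<beta> j" for j by (simp add: P_def column_def vec_eq_iff)
  then have "columns P = B" using \<beta> by (auto simp: columns_def bij_betw_def)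
  then obtain Q where PQ: "P ** Q = mat 1"
    using spB matrix_right_invertible_span_columns[of P] by (auto simp: span_vec_eq)
  then have QP: "Q ** P = mat 1" using matrix_left_right_inverse by blast
  have "\<exists>e. Q ** g ** P = diagm e" if g: "g \<in> F" for g
  proof -
    have "\<forall>j. \<exists>c. g *v \<beta> j = c *\<^sub>R \<beta> j"
      using \<beta> B(1) g by (auto simp: bij_betw_def E_def)
    then obtain e where e: "\<And>j. g *v \<beta> j = e j *\<^sub>R \<beta> j" by metis
    have "(g ** P) $ i $ j = (P ** diagm e) $ i $ j" for i j
    proof -
      have "(g ** P) $ i $ j = (g *v \<beta> j) $ i"
        by (simp add: matrix_matrix_mult_def matrix_vector_mult_def P_def)
      then show ?thesis by (simp add: e mult_diagm_nth P_def)
    qed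
    then have "g ** P = P ** diagm e" by (simp add: vec_eq_iff)
    then have "Q ** g ** P = diagm e" by (metis QP matrix_mul_assoc matrix_mul_lid)
    then show ?thesis by blast
  qed
  then have "\<forall>g\<in>F. \<exists>e. Q ** g ** P = diagm e" by simp
  with PQ QP show ?thesis by metis
qed

definition sign_diag :: "(real^'n^'n) set" where
  "sign_diag = diagm ` {e. (\<forall>i. e i = 1 \<or> e i = - 1) \<and> prod e UNIV = 1}"

lemma sign_diag_finite: "finite (sign_diag :: (real^'n^'n) set)"
proof -
  have "{e :: 'n \<Rightarrow> real. (\<forall>i. e i = 1 \<or> e i = - 1) \<and> prod e UNIV = 1} \<subseteq> UNIV \<rightarrow>\<^sub>E {1, - 1}"
    by auto
  then show ?thesis unfolding sign_diag_def by (intro finite_imageI) (rule finite_subset, auto intro: finite_PiE)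
qed

lemma sign_diag_SL: "D \<in> sign_diag \<Longrightarrow> D \<in> SL"
  by (auto simp: sign_diag_def SL_diagm)

lemma diagonal_iff_commute_sign_diag:
  fixes A :: "real^'n^'n"
  assumes n: "CARD('n) \<ge> 3"
  shows "(\<exists>d. A = diagm d) \<longleftrightarrow> (\<forall>D\<in>sign_diag. A ** D = D ** A)"
proof
  assume "\<exists>d. A = diagm d"
  then show "\<forall>D\<in>sign_diag. A ** D = D ** A"
    by (auto simp: sign_diag_def diagm_mult mult.commute)
next
  assume comm: "\<forall>D\<in>sign_diag. A ** D = D ** A"
  have "A $ k $ l = 0" if kl: "k \<noteq> l" for k l
  proof -
    obtain m where m: "m \<noteq> k" "m \<noteq> l" using ex_third[OF n] by blast
    \<comment> \<open>The second sign at \<open>m\<close> restores determinant 1 while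
      \<open>k\<close> and \<open>l\<close> get opposite signs; \<open>1 / (- 1)\<close> matches the
      shape of \<open>hyperbolic_in_transv_grp\<close>.\<close>
    define e where "e = (\<lambda>i. if i = k then - 1 else if i = m then 1 / (- 1) else 1 :: real)"
    have "det (diagm e) = 1"
      unfolding e_def by (rule transv_grp_det[OF hyperbolic_in_transv_grp]) (use m in auto)
    then have "diagm e \<in> sign_diag"
      by (auto simp: sign_diag_def det_diagm e_def)
    then have "(A ** diagm e) $ k $ l = (diagm e ** A) $ k $ l" using comm by simp
    then show ?thesis using kl m by (simp add: mult_diagm_nth diagm_mult_nth e_def)
  qed
  then have "A = diagm (\<lambda>i. A $ i $ i)" by (auto simp: vec_eq_iff diagm_nth)
  then show "\<exists>d. A = diagm d" by blast
qed

text \<open>After a conjugation the sign matrices go to diagonal involutions in \<open>SL\<close>,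
  which are sign matrices again; by finiteness they are permuted. Hence their centralizer in
  \<open>SL\<close>, the diagonal torus, is preserved.\<close>

lemma inner_or_contragredient:
  fixes f :: "real^'n^'n \<Rightarrow> real^'n^'n"
  assumes n: "CARD('n) \<ge> 3" and f: "sl_aut f"
  shows "is_inner f \<or> is_inner (\<lambda>A. f (contragredient A))"
proof -
  have invol: "D ** D = mat 1" if "D \<in> sign_diag" for D :: "real^'n^'n"
    using that by (auto simp: sign_diag_def diagm_mult diagm_eq_iff fun_eq_iff square_eq_1_iff simp flip: diagm_one)
  have comm: "D ** D' = D' ** D" if "D \<in> sign_diag" "D' \<in> sign_diag" for D D' :: "real^'n^'n"
    using that by (auto simp: sign_diag_def diagm_mult mult.commute)
  have "\<exists>(P :: real^'n^'n) Q. P ** Q = mat 1 \<and> Q ** P = mat 1 \<and> (\<forall>g\<in>f ` sign_diag. \<exists>e. Q ** g ** P = diagm e)"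
  proof (rule commuting_involutions_diagonalizable)
    show "finite (f ` sign_diag)" using sign_diag_finite by blast
    show "g ** g = mat 1" if "g \<in> f ` sign_diag" for g
      using that invol by (auto simp: sign_diag_SL sl_aut_one[OF f] simp flip: sl_aut_mult[OF f])
    show "g ** h = h ** g" if "g \<in> f ` sign_diag" "h \<in> f ` sign_diag" for g h
      using that comm by (auto simp: sign_diag_SL commute_image_iff[OF f])
  qed
  then obtain P Q :: "real^'n^'n" where PQ: "P ** Q = mat 1" "Q ** P = mat 1"
    and "\<forall>g\<in>f ` sign_diag. \<exists>e. Q ** g ** P = diagm e" by blast
  then have ev: "\<exists>e. Q ** f D ** P = diagm e" if "D \<in> sign_diag" for D
    using that by simp
  define f' where "f' A = Q ** f A ** P" for A :: "real^'n^'n"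
  have f': "sl_aut f'" unfolding f'_def[abs_def] by (rule sl_aut_comp[OF sl_aut_conj[OF PQ(2)] f])
  have "f' ` sign_diag \<subseteq> sign_diag"
  proof
    fix X assume "X \<in> f' ` sign_diag"
    then obtain D where D: "D \<in> sign_diag" "X = f' D" by blast
    then obtain e where e: "X = diagm e" using ev unfolding f'_def by blast
    have "X ** X = mat 1"
      using D invol by (simp add: sign_diag_SL sl_aut_one[OF f'] flip: sl_aut_mult[OF f'])
    then have "\<forall>i. e i = 1 \<or> e i = - 1"
      by (simp add: e diagm_mult diagm_eq_iff fun_eq_iff square_eq_1_iff flip: diagm_one)
    moreover have "prod e UNIV = 1"
      using sl_aut_in[OF f' sign_diag_SL[OF D(1)]] unfolding D(2)[symmetric] e SL_diagm .
    ultimately show "X \<in> sign_diag" unfolding e sign_diag_def by blast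
  qed
  moreover have "inj_on f' sign_diag"
    using sl_aut_inj[OF f'] sign_diag_SL by (auto simp: inj_on_def)
  ultimately have im: "f' ` sign_diag = sign_diag"
    by (rule endo_inj_surj[OF sign_diag_finite])
  have "(\<exists>d. f' A = diagm d) \<longleftrightarrow> (\<exists>d. A = diagm d)" if A: "A \<in> SL" for A
  proof -
    have "(\<exists>d. f' A = diagm d) \<longleftrightarrow> (\<forall>D\<in>f' ` sign_diag. f' A ** D = D ** f' A)"
      unfolding im by (rule diagonal_iff_commute_sign_diag[OF n])
    also have "\<dots> \<longleftrightarrow> (\<forall>D\<in>sign_diag. A ** D = D ** A)"
      using A by (auto simp: commute_image_iff[OF f'] sign_diag_SL)
    also have "\<dots> \<longleftrightarrow> (\<exists>d. A = diagm d)"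
      by (rule diagonal_iff_commute_sign_diag[OF n, symmetric])
    finally show ?thesis .
  qed
  then have "is_inner f' \<or> is_inner (\<lambda>A. f' (contragredient A))"
    using inner_or_contragredient_if_diagonal_preserved[OF n f'] by blast
  then show ?thesis
    unfolding f'_def[abs_def]
    using inner_conj[OF PQ(2,1), of f] inner_conj[OF PQ(2,1), of "\<lambda>A. f (contragredient A)"] by blast
qed

section \<open>Local automorphisms\<close>

text \<open>If two numbers are at least 2, their sum is at most their product, because
  \<open>(x - 1) * (y - 1) \<ge> 1\<close>.\<close>

lemma sum_le_prod:
  fixes p :: "'a \<Rightarrow> real"
  assumes "finite S" "S \<noteq> {}" "\<And>i. i \<in> S \<Longrightarrow> p i \<ge> 2"
  shows "sum p S \<le> prod p S \<and> 2 \<le> prod p S"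
  using assms
proof (induction S rule: finite_ne_induct)
  case (insert x S)
  then have IH: "sum p S \<le> prod p S" "2 \<le> prod p S" and x: "p x \<ge> 2" by auto
  have "0 \<le> (p x - 1) * (prod p S - 1) - 1"
    using mult_mono[of 1 "p x - 1" 1 "prod p S - 1"] IH x by simp
  then have "p x + prod p S \<le> p x * prod p S" by (simp add: algebra_simps)
  then show ?case using insert.hyps IH x by simp
qed auto

text \<open>Take distinct integers at least 2 and the reciprocal of their product \<open>r\<close>:
  the sum of the integers is at most \<open>r\<close>, and two of their reciprocals already exceed
  \<open>inverse r\<close>. The gap between the traces of the matrix and its inverse later excludes
  the contragredient type.\<close>

lemma generic_diagonal:
  assumes n: "CARD('n::finite) \<ge> 3"
  obtains d :: "'n::finite \<Rightarrow> real"
  where "inj d" "prod d UNIV = 1" "sum d UNIV < (\<Sum>i\<in>UNIV. inverse (d i))"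
proof -
  obtain h :: "'n \<Rightarrow> nat" where h: "inj h"
    using finite_imp_inj_to_nat_seg[of "UNIV :: 'n set"] by auto
  obtain o' :: 'n where True by simp
  define S where "S = - {o'}"
  define p where "p i = real (h i) + 2" for i
  define r where "r = prod p S"
  define d where "d i = (if i = o' then inverse r else p i)" for i
  obtain j where j: "j \<in> S" using ex_third[OF n, of o' o'] by (auto simp: S_def)
  obtain k where k: "k \<in> S" "k \<noteq> j" using ex_third[OF n, of o' j] by (auto simp: S_def)
  have p2: "p i \<ge> 2" for i by (simp add: p_def)
  have S: "sum p S \<le> r" "2 \<le> r" using sum_le_prod[of S p] j p2 by (auto simp: r_def)
  have split: "sum g UNIV = g o' + sum g S" for g :: "'n \<Rightarrow> real"
    unfolding S_def by (subst sum.remove[of _ o']) (auto simp: Compl_eq_Diff_UNIV)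
  have dS: "sum (\<lambda>i. g (d i)) S = sum (\<lambda>i. g (p i)) S" for g :: "real \<Rightarrow> real"
    by (intro sum.cong) (auto simp: d_def S_def)
  have "prod d UNIV = d o' * prod d S"
    unfolding S_def by (subst prod.remove[of _ o']) (auto simp: Compl_eq_Diff_UNIV)
  also have "prod d S = r" unfolding r_def by (intro prod.cong) (auto simp: d_def S_def)
  finally have prod: "prod d UNIV = 1" using S by (simp add: d_def)
  have "inverse r < 2" using S(2) by (simp add: field_simps)
  then have lt: "inverse r < p i" for i using p2[of i] by linarith
  have inj: "inj d"
  proof (rule injI)
    fix x y assume "d x = d y"
    then show "x = y" using h lt[of x] lt[of y] by (auto simp: d_def p_def inj_eq split: if_splits)
  qed
  have "r = p j * prod p (S - {j})"
    unfolding r_def using j by (intro prod.remove) auto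
  moreover have "1 \<le> prod p (S - {j})" using p2 by (intro prod_ge_1) (simp add: order_trans[OF _ p2])
  ultimately have "p j \<le> r" using p2[of j] by (simp add: mult_le_cancel_left1)
  then have "inverse r \<le> inverse (p j)" using p2[of j] by (simp add: le_imp_inverse_le)
  also have "\<dots> < inverse (p j) + inverse (p k)" using p2[of k] by simp
  also have "\<dots> = sum (\<lambda>i. inverse (p i)) {j, k}" using k(2) by simp
  also have "\<dots> \<le> sum (\<lambda>i. inverse (p i)) S"
    using j k p2 by (intro sum_mono2) (auto simp: p_def)
  finally have "inverse r < sum (\<lambda>i. inverse (p i)) S" .
  then have "sum d UNIV < (\<Sum>i\<in>UNIV. inverse (d i))"
    using S split[of d] split[of "\<lambda>i. inverse (d i)"] dS[of "\<lambda>x. x"] dS[of inverse]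
    by (simp add: d_def)
  then show ?thesis using that inj prod by blast
qed

section \<open>Normalization of local automorphisms by fixed matrices\<close>

definition sl_local_aut :: "(real^'n^'n \<Rightarrow> real^'n^'n) \<Rightarrow> bool" where
  "sl_local_aut \<phi> \<longleftrightarrow> (\<forall>A\<in>SL. \<forall>B\<in>SL. \<exists>f. sl_aut f \<and> \<phi> A = f A \<and> \<phi> B = f B)"

lemma sl_local_aut_comp: "sl_aut h \<Longrightarrow> sl_local_aut \<phi> \<Longrightarrow> sl_local_aut (\<lambda>A. h (\<phi> A))"
  unfolding sl_local_aut_def by (metis sl_aut_comp)

lemma trace_transpose: "trace (transpose A) = trace A"
  by (simp add: trace_def transpose_def)

lemma trace_conj:
  fixes P :: "real^'n^'n"
  assumes "Q ** P = mat 1" shows "trace (P ** A ** Q) = trace A"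
  by (metis assms matrix_mul_assoc matrix_mul_lid trace_mul_sym)

text \<open>An automorphism of contragredient type would give \<open>\<phi> A\<close> the trace of
  \<open>matrix_inv A\<close>. So the trace at \<open>A\<close> decides the type, and one
  \<open>P\<close> serves both matrices.\<close>

lemma sl_local_aut_inner_on_pair:
  fixes \<phi> :: "real^'n^'n \<Rightarrow> real^'n^'n"
  assumes n: "CARD('n) \<ge> 3" and \<phi>: "sl_local_aut \<phi>" and A: "A \<in> SL" and B: "B \<in> SL"
    and tr: "trace (\<phi> A) \<noteq> trace (matrix_inv A)"
  obtains P Q :: "real^'n^'n" where "P ** Q = mat 1" "Q ** P = mat 1" "\<phi> A = P ** A ** Q" "\<phi> B = P ** B ** Q"
proof -
  obtain f where f: "sl_aut f" "\<phi> A = f A" "\<phi> B = f B" using \<phi> A B unfolding sl_local_aut_def by blast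
  have "is_inner f"
  proof (rule ccontr)
    assume "\<not> is_inner f"
    then have "is_inner (\<lambda>A. f (contragredient A))" using inner_or_contragredient[OF n f(1)] by blast
    then obtain P Q where PQ: "Q ** P = mat 1" "\<And>A. A \<in> SL \<Longrightarrow> f (contragredient A) = P ** A ** Q"
      unfolding is_inner_def by blast
    have "f A = P ** contragredient A ** Q"
      using PQ(2)[OF contragredient_SL[OF A]] by (simp add: contragredient_invol[OF A])
    then have "trace (f A) = trace (contragredient A)" using trace_conj[OF PQ(1)] by simp
    then show False using tr f(2) by (simp add: contragredient_def trace_transpose)
  qed
  then show ?thesis using that f A B unfolding is_inner_def by metis
qed

lemma matrix_inv_diagm:
  assumes "\<And>i. d i \<noteq> 0" shows "matrix_inv (diagm d) = diagm (\<lambda>i. inverse (d i))"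
  using inv_uniq[OF diagm_inverse(1)] assms .

lemma trace_diagm_mult: "trace (diagm d ** A) = (\<Sum>i\<in>UNIV. d i * A $ i $ i)"
  by (simp add: trace_def diagm_mult_nth)

text \<open>Pair \<open>B\<close> with \<open>diagm d\<close>: the conjugating matrix commutes with
  \<open>diagm d\<close>, whose entries are distinct, so it is diagonal.\<close>

lemma sl_local_aut_diagonal_conj:
  fixes \<phi> :: "real^'n^'n \<Rightarrow> real^'n^'n"
  assumes n: "CARD('n) \<ge> 3" and \<phi>: "sl_local_aut \<phi>"
    and d: "inj d" "prod d UNIV = 1" "sum d UNIV < (\<Sum>i\<in>UNIV. inverse (d i))"
    and fixd: "\<phi> (diagm d) = diagm d" and B: "B \<in> SL"
  obtains t where "\<And>i. t i \<noteq> 0" "\<And>i j. \<phi> B $ i $ j = t i * B $ i $ j / t j"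
proof -
  have dnz: "d i \<noteq> 0" for i using d(2) by (rule nonzero_of_prod_one)
  have SL: "diagm d \<in> SL" using d by (simp add: SL_diagm)
  have tr: "trace (diagm e) = sum e UNIV" for e :: "'n \<Rightarrow> real"
    by (simp add: trace_def diagm_nth)
  have "trace (\<phi> (diagm d)) \<noteq> trace (matrix_inv (diagm d))"
    using d(3) by (simp add: fixd matrix_inv_diagm dnz tr)
  then obtain P Q :: "real^'n^'n" where PQ: "P ** Q = mat 1" "Q ** P = mat 1"
    "\<phi> (diagm d) = P ** diagm d ** Q" "\<phi> B = P ** B ** Q"
    using sl_local_aut_inner_on_pair[OF n \<phi> SL B] by blast
  have "diagm d ** P = P ** diagm d"
    using PQ(2,3) fixd by (metis matrix_mul_assoc matrix_mul_rid)
  then have "d i * P $ i $ j = P $ i $ j * d j" for i j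
    by (metis diagm_mult_nth mult_diagm_nth)
  then have "P $ i $ j = 0" if "i \<noteq> j" for i j
    using d(1) that by (metis inj_eq mult.commute mult_right_cancel)
  then have P: "P = diagm (\<lambda>i. P $ i $ i)" by (auto simp: vec_eq_iff diagm_nth)
  define t where "t i = P $ i $ i" for i
  have Pt: "P = diagm t" using P by (simp add: t_def[abs_def])
  have "det P \<noteq> 0" using PQ(1) by (metis det_I det_mul mult_zero_left zero_neq_one)
  then have tnz: "t i \<noteq> 0" for i by (simp add: Pt det_diagm)
  have "\<phi> B ** P = P ** B" using PQ(2,4) by (metis matrix_mul_assoc matrix_mul_rid)
  then have "\<phi> B $ i $ j * t j = t i * B $ i $ j" for i j
    unfolding Pt by (metis diagm_mult_nth mult_diagm_nth)
  then have "\<phi> B $ i $ j = t i * B $ i $ j / t j" for i j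
    using tnz[of j] by (simp add: field_simps)
  then show ?thesis using that tnz by blast
qed

lemma sl_local_aut_fixing_generic:
  fixes \<phi> :: "real^'n^'n \<Rightarrow> real^'n^'n"
  assumes n: "CARD('n) \<ge> 3" and \<phi>: "sl_local_aut \<phi>"
    and d: "inj d" "prod d UNIV = 1" "sum d UNIV < (\<Sum>i\<in>UNIV. inverse (d i))"
    and fixd: "\<phi> (diagm d) = diagm d"
    and u: "u \<in> SL" "\<And>i j. i \<noteq> j \<Longrightarrow> u $ i $ j \<noteq> 0" and fixu: "\<phi> u = u"
    and B: "B \<in> SL"
  shows "\<phi> B = B"
proof -
  have dnz: "d i \<noteq> 0" for i using d(2) by (rule nonzero_of_prod_one)
  note conj = sl_local_aut_diagonal_conj[OF n \<phi> d fixd]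
  have diag: "\<phi> A $ i $ i = A $ i $ i" if A: "A \<in> SL" for A i
  proof -
    obtain t where "\<And>i. t i \<noteq> 0" "\<And>i j. \<phi> A $ i $ j = t i * A $ i $ j / t j" using conj[OF A] by blast
    then show ?thesis by simp
  qed
  have off: "\<phi> B $ j $ i = B $ j $ i" if ij: "i \<noteq> j" for i j
  proof -
    let ?a = "\<lambda>c. diagm d ** transv i j c"
    have a_SL: "?a 1 \<in> SL" using ij d by (simp add: SL_mult SL_transv SL_diagm)
    have tr_mult: "trace (?a c ** A) = (\<Sum>k\<in>UNIV. d k * A $ k $ k) + d i * c * A $ j $ i" for c A
    proof -
      have "trace (?a c ** A) = (\<Sum>k\<in>UNIV. d k * A $ k $ k + (if k = i then d i * c * A $ j $ i else 0))"
        unfolding matrix_mul_assoc[symmetric] trace_diagm_mult transv_mult_nth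
        by (intro sum.cong) (auto simp: algebra_simps)
      then show ?thesis by (simp add: sum.distrib)
    qed
    obtain t where t: "\<And>i. t i \<noteq> 0" "\<And>k l. \<phi> (?a 1) $ k $ l = t k * ?a 1 $ k $ l / t l"
      using conj[OF a_SL] by blast
    define c where "c = t i / t j"
    \<comment> \<open>A diagonal conjugation leaves \<open>diagm d\<close> alone and only rescales
      the parameter of the transvection.\<close>
    have \<phi>a: "\<phi> (?a 1) = ?a c"
      using t(1) ij by (auto simp: vec_eq_iff t(2)) (auto simp: diagm_mult_nth transv_nth c_def)
    have "?a 1 ** (transv i j (- 1) ** diagm (\<lambda>i. inverse (d i)))
        = diagm d ** (transv i j 1 ** transv i j (- 1)) ** diagm (\<lambda>i. inverse (d i))"
      by (simp only: matrix_mul_assoc)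
    also have "\<dots> = mat 1" using ij dnz by (simp add: transv_add diagm_inverse)
    finally have inv: "matrix_inv (?a 1) = transv i j (- 1) ** diagm (\<lambda>i. inverse (d i))"
      by (rule inv_uniq)
    have "trace (matrix_inv (?a 1)) = (\<Sum>i\<in>UNIV. inverse (d i))"
      unfolding inv trace_mul_sym[of "transv i j (- 1)"] trace_diagm_mult using ij
      by (intro sum.cong) (auto simp: transv_nth)
    moreover have "trace (\<phi> (?a 1)) = sum d UNIV"
      unfolding \<phi>a trace_diagm_mult using ij by (intro sum.cong) (auto simp: transv_nth)
    ultimately have tr: "trace (\<phi> (?a 1)) \<noteq> trace (matrix_inv (?a 1))" using d(3) by simp
    \<comment> \<open>Joint conjugation preserves the trace of the product; the diagonal entries are
      known to be fixed, so only the \<open>(j, i)\<close> entries are compared.\<close>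
    have pair: "c * \<phi> A $ j $ i = A $ j $ i" if A: "A \<in> SL" for A
    proof -
      obtain P Q :: "real^'n^'n" where PQ: "P ** Q = mat 1" "Q ** P = mat 1"
        "\<phi> (?a 1) = P ** ?a 1 ** Q" "\<phi> A = P ** A ** Q"
        using sl_local_aut_inner_on_pair[OF n \<phi> a_SL A tr] by blast
      have "\<phi> (?a 1) ** \<phi> A = P ** (?a 1 ** A) ** Q"
        using PQ by (metis matrix_mul_assoc matrix_mul_rid)
      then have "trace (?a c ** \<phi> A) = trace (?a 1 ** A)"
        using trace_conj[OF PQ(2)] by (simp add: \<phi>a)
      then show ?thesis using dnz[of i] by (simp add: tr_mult diag[OF A])
    qed
    \<comment> \<open>The fixed matrix \<open>u\<close> has a nonzero \<open>(j, i)\<close> entry,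
      which determines the unknown scaling.\<close>
    have "c = 1" using pair[OF u(1)] u(2)[of j i] ij by (simp add: fixu)
    then show ?thesis using pair[OF B] by simp
  qed
  show ?thesis using diag[OF B] off by (metis vec_eq_iff)
qed

text \<open>Take the identity plus the all-ones matrix. In a kernel vector every coordinate is minus
  the sum \<open>s\<close> of all of them, so \<open>(1 + CARD('n)) * s = 0\<close>. Scaling one row
  then makes the determinant 1.\<close>

lemma nowhere_zero_in_SL:
  obtains u :: "real^'n^'n" where "u \<in> SL" "\<And>i j. u $ i $ j \<noteq> 0"
proof -
  define v :: "real^'n^'n" where "v = (\<chi> i j. 1 + of_bool (i = j))"
  have mul: "(v *v x) $ i = x $ i + (\<Sum>j\<in>UNIV. x $ j)" for x i
  proof -
    have "(v *v x) $ i = (\<Sum>j\<in>UNIV. (if j = i then x $ j else 0) + x $ j)"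
      unfolding v_def matrix_vector_mult_def vec_lambda_beta by (intro sum.cong) auto
    then show ?thesis by (simp add: sum.distrib)
  qed
  have "x = 0" if x: "v *v x = 0" for x
  proof -
    define s where "s = (\<Sum>j\<in>UNIV. x $ j)"
    have xi: "x $ i = - s" for i using mul[of x i] x by (simp add: s_def)
    have "(\<Sum>j\<in>UNIV. x $ j) = (\<Sum>j\<in>(UNIV :: 'n set). - s)" by (rule sum.cong) (simp_all add: xi)
    then have "s = (\<Sum>j\<in>(UNIV :: 'n set). - s)" by (simp only: s_def)
    also have "\<dots> = - real CARD('n) * s" by simp
    finally have "(1 + real CARD('n)) * s = 0" by (simp add: algebra_simps)
    then have "s = 0" by (metis mult_eq_0_iff of_nat_Suc of_nat_eq_0_iff nat.distinct(1))
    then have "x $ i = 0" for i using xi[of i] by simp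
    then show ?thesis by (simp add: vec_eq_iff)
  qed
  then have "\<exists>w. w ** v = mat 1" using matrix_left_invertible_ker by blast
  then have det: "det v \<noteq> 0" by (metis det_I det_mul mult_zero_right zero_neq_one)
  obtain k :: 'n where True by simp
  define e where "e i = (if i = k then inverse (det v) else 1)" for i
  have "prod e UNIV = inverse (det v)"
    by (simp add: e_def)
  then have "diagm e ** v \<in> SL" using det by (simp add: SL_def det_mul det_diagm)
  moreover have "(diagm e ** v) $ i $ j \<noteq> 0" for i j
    using det by (simp add: diagm_mult_nth e_def v_def)
  ultimately show ?thesis using that by blast
qed

lemma sl_local_aut_imp_aut:
  fixes \<phi> :: "real^'n^'n \<Rightarrow> real^'n^'n"
  assumes n: "CARD('n) \<ge> 3" and \<phi>: "sl_local_aut \<phi>"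
  shows "sl_aut \<phi>"
proof -
  obtain d :: "'n \<Rightarrow> real" where d: "inj d" "prod d UNIV = 1" "sum d UNIV < (\<Sum>i\<in>UNIV. inverse (d i))"
    using generic_diagonal[OF n] by blast
  obtain u :: "real^'n^'n" where u: "u \<in> SL" "\<And>i j. u $ i $ j \<noteq> 0" using nowhere_zero_in_SL by blast
  have dSL: "diagm d \<in> SL" using d by (simp add: SL_diagm)
  \<comment> \<open>Composing with the inverse of an automorphism that agrees with
    \<open>\<phi>\<close> at \<open>diagm d\<close> makes this matrix fixed.\<close>
  obtain f where f: "sl_aut f" "\<phi> (diagm d) = f (diagm d)" using \<phi> dSL unfolding sl_local_aut_def by blast
  define h where "h = inv_into SL f"
  have h: "sl_aut h" unfolding h_def by (rule sl_aut_inv_into[OF f(1)])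
  have hf: "h (f A) = A" if "A \<in> SL" for A
    using f(1) that bij_betw_inv_into_left[of f SL SL A] unfolding h_def sl_aut_def by blast
  have fh: "f (h A) = A" if "A \<in> SL" for A
    using f(1) that bij_betw_inv_into_right[of f SL SL A] unfolding h_def sl_aut_def by blast
  have \<phi>_SL: "\<phi> A \<in> SL" if "A \<in> SL" for A
    using \<phi> that sl_aut_in unfolding sl_local_aut_def by metis
  have \<phi>1: "sl_local_aut (\<lambda>A. h (\<phi> A))" by (rule sl_local_aut_comp[OF h \<phi>])
  have fix1: "h (\<phi> (diagm d)) = diagm d" by (simp add: f(2) hf dSL)
  obtain t where t: "\<And>i. t i \<noteq> 0" "\<And>i j. h (\<phi> u) $ i $ j = t i * u $ i $ j / t j"
    using sl_local_aut_diagonal_conj[OF n \<phi>1 d fix1 u(1)] by blast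
  \<comment> \<open>Undoing the diagonal conjugation that moves \<open>u\<close> makes
    \<open>u\<close> fixed as well; \<open>diagm d\<close> stays fixed because diagonal matrices
    commute.\<close>
  define P where "P = diagm t"
  define Q where "Q = diagm (\<lambda>i. inverse (t i))"
  have PQ: "P ** Q = mat 1" "Q ** P = mat 1"
    unfolding P_def Q_def by (rule diagm_inverse[OF t(1)])+
  have "Q ** h (\<phi> A) ** P = A" if A: "A \<in> SL" for A
  proof (rule sl_local_aut_fixing_generic[where \<phi> = "\<lambda>A. Q ** h (\<phi> A) ** P", OF n _ d _ u(1) _ _ A])
    show "sl_local_aut (\<lambda>A. Q ** h (\<phi> A) ** P)" by (rule sl_local_aut_comp[OF sl_aut_conj[OF PQ(2)] \<phi>1])
    show "Q ** h (\<phi> (diagm d)) ** P = diagm d"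
      unfolding fix1 using t(1) by (simp add: Q_def P_def diagm_mult field_simps)
    show "u $ i $ j \<noteq> 0" for i j by (rule u(2))
    show "Q ** h (\<phi> u) ** P = u"
      using t(1) by (simp add: vec_eq_iff Q_def P_def mult_diagm_nth diagm_mult_nth t(2))
  qed
  then have "h (\<phi> A) = P ** A ** Q" if "A \<in> SL" for A
    using that PQ(1) by (metis matrix_mul_assoc matrix_mul_lid matrix_mul_rid)
  then have eq: "\<phi> A = f (P ** A ** Q)" if "A \<in> SL" for A
    using fh[OF \<phi>_SL[OF that]] that by simp
  have g: "sl_aut (\<lambda>A. f (P ** A ** Q))" by (rule sl_aut_comp[OF f(1) sl_aut_conj[OF PQ(1)]])
  have "bij_betw \<phi> SL SL"
    using g eq unfolding sl_aut_def by (simp cong: bij_betw_cong)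
  moreover have "\<phi> (A ** B) = \<phi> A ** \<phi> B" if "A \<in> SL" "B \<in> SL" for A B
    using that SL_mult[OF that] sl_aut_mult[OF g that] by (simp add: eq)
  ultimately show ?thesis unfolding sl_aut_def by blast
qed

lemma iso_special_linear_group:
  "f \<in> iso special_linear_group special_linear_group \<longleftrightarrow> sl_aut f"
  by (auto simp: iso_def hom_def sl_aut_def special_linear_group_def SL_def bij_betw_def)

theorem theorem3p1:
  fixes \<phi> :: "real ^ 'n ^ 'n \<Rightarrow> real ^ 'n ^ 'n"
  assumes "CARD('n) \<ge> 3"
    and "local_automorphism special_linear_group \<phi>"
  shows "\<phi> \<in> iso special_linear_group special_linear_group"
proof -
  have "carrier special_linear_group = (SL :: (real^'n^'n) set)"
    by (simp add: special_linear_group_def SL_def)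
  then have "sl_local_aut \<phi>"
    using assms(2) unfolding local_automorphism_def sl_local_aut_def
    by (metis iso_special_linear_group)
  then show ?thesis using sl_local_aut_imp_aut[OF assms(1)] by (simp add: iso_special_linear_group)
qed

end
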